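(* Let $r \geq 3$ and $k \geq r+3$ be integers, and let $\mathcal H$ be an $r$-uniform hypergraph on $n$ vertices with no Berge cycle of length $k$ or longer. Then $$e(\mathcal H) \leq \frac{n-1}{k-2}\binom{k-1}{r}.$$ Moreover, equality holds if and only if the graph $\partial_2 \mathcal H$ is connected and for every block $D$ of $\partial_2 \mathcal H$, $D$ is a complete graph $K_{k-1}$ on $k-1$ vertices and $\mathcal H[D] = K_{k-1}^{(r)}$.
   Context: An $r$-uniform hypergraph ($r$-graph) $\mathcal H$ is a family of (distinct) $r$-element subsets, called edges or hyperedges, of a finite vertex set $V(\mathcal H)$; $e(\mathcal H)=|\mathcal H|$ is its number of edges, and "$n$-vertex" means $|V(\mathcal H)|=n$ ($n\ge 1$). A Berge cycle of length $\ell$ in $\mathcal H$ consists of $\ell$ distinct vertices $v_1,\dots,v_\ell$ and $\ell$ distinct hyperedges $e_1,\dots,e_\ell$ of $\mathcal H$ such that $\{v_i,v_{i+1}\}\subseteq e_i$ for all $i$, with indices taken modulo $\ell$. The 2-shadow $\partial_2\mathcal H$ is the graph on vertex set $V(\mathcal H)$ whose edges are the pairs contained in some edge of $\mathcal H$. A block of a graph is a maximal subgraph that is either 2-connected (with at least 3 vertices) or a single edge that is a bridge; thus a one-vertex graph has no blocks. For a block $D$, $\mathcal H[D]$ denotes the hypergraph on vertex set $V(D)$ formed by the edges of $\mathcal H$ contained in $V(D)$. $K^{(r)}_{m}$ is the complete $r$-graph on $m$ vertices (all $r$-subsets). *)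

theory Defs
  imports Complex_Main "HOL-Library.Ramsey" "Graph_Theory.Graph_Theory"
begin

(* An r-graph is given by its vertex set V and its edge set H; [V]^r (nsets, from Ramsey)
   is the set of all r-element subsets of V. *)
definition uniform_hypergraph :: "nat \<Rightarrow> 'a set \<Rightarrow> 'a set set \<Rightarrow> bool" where
  "uniform_hypergraph r V H \<longleftrightarrow> finite V \<and> H \<subseteq> [V]\<^bsup>r\<^esup>"

definition complete_hypergraph :: "nat \<Rightarrow> nat \<Rightarrow> 'a set \<Rightarrow> 'a set set \<Rightarrow> bool" where
  "complete_hypergraph m r V H \<longleftrightarrow> finite V \<and> card V = m \<and> H = [V]\<^bsup>r\<^esup>"

definition edges_within :: "'a set set \<Rightarrow> 'a set \<Rightarrow> 'a set set" where
  "edges_within H W = {e \<in> H. e \<subseteq> W}"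

(* The vertices and hyperedges of the cycle are v 0, ..., v (l - 1) and e 0, ..., e (l - 1);
   the values of v and e at other arguments are irrelevant. *)
definition berge_cycle ::
  "'a set \<Rightarrow> 'a set set \<Rightarrow> nat \<Rightarrow> (nat \<Rightarrow> 'a) \<Rightarrow> (nat \<Rightarrow> 'a set) \<Rightarrow> bool" where
  "berge_cycle V H l v e \<longleftrightarrow>
     inj_on v {..<l} \<and> v ` {..<l} \<subseteq> V \<and>
     inj_on e {..<l} \<and> e ` {..<l} \<subseteq> H \<and>
     (\<forall>i<l. {v i, v ((i + 1) mod l)} \<subseteq> e i)"

(* As in Graph_Theory, a simple graph is a symmetric loopfree digraph (locale graph):
   an undirected edge uv is the pair of arcs (u,v), (v,u). *)
definition shadow2 :: "'a set \<Rightarrow> 'a set set \<Rightarrow> ('a, 'a \<times> 'a) pre_digraph" where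
  "shadow2 V H = with_proj
     \<lparr> pverts = V, parcs = {(x, y). x \<noteq> y \<and> (\<exists>e\<in>H. {x, y} \<subseteq> e)} \<rparr>"

definition two_connected :: "('a, 'b) pre_digraph \<Rightarrow> bool" where
  "two_connected G \<longleftrightarrow>
     graph G \<and> card (verts G) \<ge> 3 \<and> Digraph_Component.connected G \<and>
     (\<forall>v \<in> verts G. Digraph_Component.connected (pre_digraph.del_vert G v))"

(* Deleting an undirected edge means deleting both of its arcs. *)
definition bridge :: "('a, 'a \<times> 'a) pre_digraph \<Rightarrow> 'a \<Rightarrow> 'a \<Rightarrow> bool" where
  "bridge G x y \<longleftrightarrow>
     (x, y) \<in> arcs G \<and>
     \<not> reachable (pre_digraph.del_arc (pre_digraph.del_arc G (x, y)) (y, x)) x y"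

(* Maximality is with respect to the library's subgraph relation, among all subgraphs of G
   that are 2-connected or a bridge of G. *)
definition block :: "('a, 'a \<times> 'a) pre_digraph \<Rightarrow> ('a, 'a \<times> 'a) pre_digraph \<Rightarrow> bool" where
  "block G D \<longleftrightarrow>
     pre_digraph.max_subgraph G
       (\<lambda>B. two_connected B \<or>
            (\<exists>x y. bridge G x y \<and> verts B = {x, y} \<and> arcs B = {(x, y), (y, x)})) D"

end

theory Submission
  imports Defs
begin

text \<open>
  The hypergraph is first replaced by a graph. Choose a set \<open>A\<close> of hyperedges for which the number of
  hyperedges in \<open>A\<close> minus the number of pairs covered by them is as large as possible. Hall's theorem
  then represents every hyperedge outside \<open>A\<close> by one of its own pairs, injectively and by pairs that
  \<open>A\<close> does not cover, and represents every pair covered by \<open>A\<close> by a member of \<open>A\<close> around it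
  (\<open>surplus_decomposition\<close>, \<open>hall_representatives\<close>). Let \<open>F\<close> consist of \<open>A\<close> and of the chosen pairs.
  It has as many members as the hypergraph, no pair in \<open>F\<close> lies inside an \<open>r\<close>-set in \<open>F\<close>, and every
  cycle of the shadow graph of \<open>F\<close> lifts to a Berge cycle of the same length. It therefore suffices to
  bound such families \<open>F\<close> of 2-sets and \<open>r\<close>-sets when their shadow graph has no cycle of length at
  least \<open>k\<close>.

  This is an induction on the number of vertices (\<open>mixed_family_bound\<close>), in which every removed
  vertex may cost \<open>(k - 1 choose r) / (k - 2)\<close> members. A vertex of degree at most \<open>(k - 1) /
  2\<close> is cheap enough, even if it lies only on pairs, because \<open>k \<ge> r + 3\<close>. If there is no
  such vertex, take a longest path whose first vertex has a neighbour as far along the path as possible. The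
  part of the path up to that neighbour \<open>w\<close> closes to a cycle, so its vertex set \<open>L\<close>
  has fewer than \<open>k\<close> elements, and a rotation argument shows that every vertex of \<open>L\<close>
  except \<open>w\<close> has all its neighbours in \<open>L\<close> (\<open>exists_pendant_set\<close>).
  Removing \<open>L - {w}\<close> costs only members inside \<open>L\<close>, and a double count of their pairs
  shows that this is affordable, with equality only if \<open>L\<close> has \<open>k - 1\<close> elements and
  all its pairs are covered.

  Families attaining the bound are thus glued from cliques on \<open>k - 1\<close> vertices along single vertices
  (\<open>clique_tree\<close>). Equality never comes from a cheap vertex: any two vertices of a clique tree are
  joined by a path with at least \<open>k - 1\<close> vertices, which together with a new vertex adjacent to both
  would be too long a cycle. Moreover, among the optimal sets \<open>A\<close> a largest one leaves freedom in
  the choice of pairs: if some hyperedge were outside \<open>A\<close>, one representing pair could be exchanged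
  for a new one, and both families would be clique trees. This is impossible, because two vertices of
  a clique tree with two common neighbours are adjacent, so no edge can be taken away in this manner.
  Hence in the case of equality the hypergraph itself is a clique tree (\<open>berge_bound\<close>).

  Finally, 2-connected subgraphs and single edges of a clique tree stay inside one clique, which
  identifies the blocks (\<open>piece_within_clique\<close>). Conversely, if the shadow graph is connected and
  all blocks are complete pieces, each cycle lies in a block and so has fewer than \<open>k\<close> vertices; the pendant
  sets \<open>L\<close> found above are then complete pieces, and peeling them off one by one counts the hyperedges
  exactly (\<open>complete_pieces_count\<close>).
\<close>


section \<open>Paths and cycles in a graph\<close>

definition graph_path :: "('a \<Rightarrow> 'a \<Rightarrow> bool) \<Rightarrow> 'a list \<Rightarrow> bool" where
  "graph_path E xs \<longleftrightarrow> distinct xs \<and> successively E xs"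

definition graph_cycle :: "('a \<Rightarrow> 'a \<Rightarrow> bool) \<Rightarrow> 'a list \<Rightarrow> bool" where
  "graph_cycle E xs \<longleftrightarrow> graph_path E xs \<and> 3 \<le> length xs \<and> E (last xs) (hd xs)"

lemma graph_path_append_iff:
  "graph_path E (xs @ ys) \<longleftrightarrow> graph_path E xs \<and> graph_path E ys \<and> set xs \<inter> set ys = {} \<and>
     (xs = [] \<or> ys = [] \<or> E (last xs) (hd ys))"
  by (auto simp: graph_path_def successively_append_iff)

lemma graph_path_rev: "symp E \<Longrightarrow> graph_path E (rev xs) \<longleftrightarrow> graph_path E xs"
proof -
  assume "symp E"
  then have "(\<lambda>x y. E y x) = E" by (auto simp: symp_def fun_eq_iff)
  then show ?thesis unfolding graph_path_def successively_rev distinct_rev by (simp only:)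
qed

lemma card_indices_eq:
  assumes "distinct xs" "A \<subseteq> set xs"
  shows "card {j. j < length xs \<and> xs ! j \<in> A} = card A"
proof -
  have "bij_betw (\<lambda>j. xs ! j) {j. j < length xs \<and> xs ! j \<in> A} A"
    using assms by (auto simp: bij_betw_def inj_on_def nth_eq_iff_index_eq in_set_conv_nth)
      (metis (mono_tags, lifting) image_eqI in_set_conv_nth mem_Collect_eq subsetD)
  then show ?thesis by (rule bij_betw_same_card)
qed

text \<open>
  The crossing argument of Dirac and Ore. If the two facing ends \<open>x\<close> and \<open>y\<close> of the paths are not
  adjacent, the degree sum forces two consecutive vertices on the concatenated list, the first adjacent
  to \<open>x\<close> and the second adjacent to \<open>y\<close>; reversing the stretch between this place and the gap
  gives a path with the same vertices and the same outer ends.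
\<close>
lemma join_paths_by_crossing:
  assumes E: "symp E" "irreflp E"
    and us: "graph_path E us" "us \<noteq> []" and ws: "graph_path E ws" "ws \<noteq> []"
    and disj: "set us \<inter> set ws = {}"
    and nbx: "{z. E (last us) z} \<subseteq> set (us @ ws)"
    and nby: "{z. E (hd ws) z} \<subseteq> set (us @ ws)"
    and deg: "length (us @ ws) < card {z. E (last us) z} + card {z. E (hd ws) z}"
  shows "\<exists>zs. graph_path E zs \<and> set zs = set (us @ ws) \<and> zs \<noteq> [] \<and> hd zs = hd us \<and> last zs = last ws"
proof (cases "E (last us) (hd ws)")
  case True
  then show ?thesis using us ws disj by (intro exI[of _ "us @ ws"]) (auto simp: graph_path_append_iff)
next
  case False
  define w where "w = us @ ws"
  define x y where "x = last us" and "y = hd ws"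
  define p where "p = length us - 1"
  have sym: "E a b \<Longrightarrow> E b a" for a b using E by (auto simp: symp_def)
  have irr: "\<not> E a a" for a using E by (auto simp: irreflp_def)
  have dw: "distinct w" using us ws disj by (auto simp: w_def graph_path_def)
  have wp: "w ! p = x" using us by (simp add: w_def p_def x_def nth_append last_conv_nth)
  have wp1: "w ! Suc p = y" using us ws by (simp add: w_def p_def y_def nth_append hd_conv_nth)
  have pl: "Suc p < length w" using us ws by (simp add: w_def p_def)
  define S T where "S = {j. j < length w \<and> w ! j \<in> {z. E x z}}"
    and "T = {j. j < length w \<and> w ! j \<in> {z. E y z}}"
  have cS: "card S = card {z. E x z}" unfolding S_def
    by (rule card_indices_eq[OF dw]) (use nbx in \<open>simp add: w_def x_def\<close>)
  have cT: "card T = card {z. E y z}" unfolding T_def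
    by (rule card_indices_eq[OF dw]) (use nby in \<open>simp add: w_def y_def\<close>)
  \<comment> \<open>Pigeonhole on the positions: position \<open>Suc p\<close> is missed because neither \<open>x\<close> nor \<open>y\<close> is its own
    neighbour, so only \<open>length w\<close> positions are left for the two neighbourhoods.\<close>
  have "Suc ` S \<inter> T \<noteq> {}"
  proof
    assume e: "Suc ` S \<inter> T = {}"
    have "Suc ` S \<union> T \<subseteq> {..length w} - {Suc p}"
      using wp wp1 irr by (auto simp: S_def T_def)
    moreover have "card ({..length w} - {Suc p}) = length w" using pl by simp
    ultimately have "card (Suc ` S \<union> T) \<le> length w"
      by (metis card_mono finite_Diff finite_atMost)
    moreover have "card (Suc ` S \<union> T) = card S + card T"
      using e by (subst card_Un_disjoint) (auto simp: S_def T_def card_image)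
    ultimately show False using deg cS cT by (simp add: w_def x_def y_def)
  qed
  then obtain j where j: "j \<in> S" "Suc j \<in> T" by auto
  have jl: "Suc j < length w" and Ex: "E x (w ! j)" and Ey: "E y (w ! Suc j)"
    using j by (auto simp: S_def T_def)
  have jp: "j \<noteq> p" using Ex wp irr by auto
  have jp': "j \<noteq> Suc p" using Ex wp1 False by (auto simp: x_def y_def)
  have ul: "length us = Suc p" using us by (cases us) (auto simp: p_def)
  show ?thesis
  proof (cases "j < p")
    case True
    define a b where "a = take (Suc j) us" and "b = drop (Suc j) us"
    have ab: "us = a @ b" by (simp add: a_def b_def)
    have ne: "a \<noteq> []" "b \<noteq> []" using True ul us by (auto simp: a_def b_def)
    have la: "last a = w ! j" using True ul
      by (simp add: a_def w_def nth_append last_conv_nth us min_def)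
    have hb: "hd b = w ! Suc j" using True ul
      by (simp add: b_def w_def nth_append hd_drop_conv_nth)
    have lb: "last b = x" using ne by (simp add: x_def ab)
    show ?thesis
      using us ws disj ne Ex Ey sym
      by (intro exI[of _ "a @ rev b @ ws"])
         (auto simp: ab graph_path_append_iff graph_path_rev[OF E(1)] hd_append hd_rev last_rev la hb lb y_def)
  next
    case False
    then have jg: "Suc p < j" using jp jp' by simp
    define c d where "c = take (j - p) ws" and "d = drop (j - p) ws"
    have cd: "ws = c @ d" by (simp add: c_def d_def)
    have jl2: "j - p < length ws" using jl jg ul by (simp add: w_def)
    have ne: "c \<noteq> []" "d \<noteq> []" using jg ul ws jl by (auto simp: c_def d_def w_def)
    have lc: "last c = w ! j" using jg ul jl jl2
      by (simp add: c_def w_def nth_append last_conv_nth ws min_def)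
    have hd': "hd d = w ! Suc j" using jg ul jl jl2
      by (simp add: d_def w_def nth_append hd_drop_conv_nth Suc_diff_le)
    have hc: "hd c = y" using ne by (simp add: y_def cd)
    show ?thesis
      using us ws disj ne Ex Ey sym
      by (intro exI[of _ "us @ rev c @ d"])
         (auto simp: cd graph_path_append_iff graph_path_rev[OF E(1)] hd_append hd_rev last_rev lc hd' hc x_def)
  qed
qed

text \<open>
  A form of Dirac's theorem on circumference that does without 2-connectivity: large degrees and no
  long cycle force a small set that is attached to the rest at a single vertex.
\<close>
lemma exists_pendant_set:
  fixes E :: "'a \<Rightarrow> 'a \<Rightarrow> bool"
  assumes fin: "finite V" and ne: "V \<noteq> {}" and E: "symp E" "irreflp E"
    and inV: "\<And>x y. E x y \<Longrightarrow> x \<in> V \<and> y \<in> V"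
    and deg: "\<And>x. x \<in> V \<Longrightarrow> k \<le> 2 * card {y. E x y}" and k: "3 \<le> k"
    and cyc: "\<And>xs. graph_cycle E xs \<Longrightarrow> length xs < k"
  shows "\<exists>L w. L \<subseteq> V \<and> w \<in> L \<and> 2 \<le> card L \<and> card L < k \<and>
    (\<forall>x\<in>L - {w}. \<forall>y. E x y \<longrightarrow> y \<in> L)"
proof -
  have sym: "E a b \<Longrightarrow> E b a" for a b using E by (auto simp: symp_def)
  have irr: "\<not> E a a" for a using E by (auto simp: irreflp_def)
  define good where "good = (\<lambda>(xs, ys). xs \<noteq> [] \<and> graph_path E (xs @ ys) \<and> E (hd xs) (last xs))"
  \<comment> \<open>A pair \<open>(xs, ys)\<close> is a path cut at a neighbour of its first vertex. Maximising \<open>\<Phi>\<close> takes first the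
    longest path and then the farthest cut, as the second summand is at most \<open>card V\<close>.\<close>
  define \<Phi> where "\<Phi> = (\<lambda>(xs :: 'a list, ys :: 'a list). length (xs @ ys) * Suc (card V) + length xs)"
  have inlist: "set xs \<subseteq> V" if "graph_path E xs" and len: "2 \<le> length xs" for xs
  proof
    fix z assume "z \<in> set xs"
    then obtain i where i: "i < length xs" "z = xs ! i" by (auto simp: in_set_conv_nth)
    have s: "successively E xs" using that by (simp add: graph_path_def)
    show "z \<in> V"
    proof (cases "Suc i < length xs")
      case True
      then show ?thesis using successively_nth[OF s True] inV i by blast
    next
      case False
      then obtain i' where "i = Suc i'" using len i by (cases i) auto
      then show ?thesis using successively_nth[OF s, of i'] inV i by blast
    qed
  qed
  have glen: "length (xs @ ys) \<le> card V \<and> set (xs @ ys) \<subseteq> V" if "good (xs, ys)" for xs ys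
  proof -
    have p: "graph_path E (xs @ ys)" and e: "E (hd xs) (last xs)" and n: "xs \<noteq> []"
      using that by (auto simp: good_def)
    have "2 \<le> length xs" using n e irr by (cases xs rule: list.exhaust; cases "tl xs") auto
    then have "2 \<le> length (xs @ ys)" by simp
    then have s: "set (xs @ ys) \<subseteq> V" by (rule inlist[OF p])
    have "length (xs @ ys) = card (set (xs @ ys))"
      using p distinct_card unfolding graph_path_def by metis
    then show ?thesis using s card_mono[OF fin s] by simp
  qed
  have "\<exists>q. good q"
  proof -
    obtain x where x: "x \<in> V" using ne by blast
    then have "card {y. E x y} \<noteq> 0" using deg[OF x] k by auto
    then obtain y where "E x y" by fastforce
    then have "good ([x, y], [])" using irr by (auto simp: good_def graph_path_def)
    then show ?thesis by blast
  qed
  moreover have "\<forall>q. good q \<longrightarrow> \<Phi> q \<le> card V * Suc (card V) + card V"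
  proof (intro allI impI)
    fix q assume "good q"
    obtain xs ys where q: "q = (xs, ys)" by force
    have l: "length (xs @ ys) \<le> card V" using glen \<open>good q\<close> q by blast
    have "length (xs @ ys) * Suc (card V) \<le> card V * Suc (card V)" using l by (rule mult_le_mono1)
    moreover have "length xs \<le> card V" using l by simp
    ultimately have "length (xs @ ys) * Suc (card V) + length xs \<le> card V * Suc (card V) + card V"
      by (rule add_le_mono)
    then show "\<Phi> q \<le> card V * Suc (card V) + card V" by (simp add: q \<Phi>_def)
  qed
  ultimately obtain q where q: "good q" "\<And>q'. good q' \<Longrightarrow> \<Phi> q' \<le> \<Phi> q"
    using ex_has_greatest_nat[of good _ \<Phi> "Suc (card V * Suc (card V) + card V)"]
    unfolding less_Suc_eq_le by blast
  obtain xs ys where qe: "q = (xs, ys)" by force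
  have xsne: "xs \<noteq> []" and pxy: "graph_path E (xs @ ys)" and ce: "E (hd xs) (last xs)"
    using q(1) by (auto simp: good_def qe)
  have mx1: False if "good (xs', ys')" "length (xs' @ ys') > length (xs @ ys)" for xs' ys'
  proof -
    have "\<Phi> (xs', ys') \<le> \<Phi> (xs, ys)" using q(2)[OF that(1)] by (simp add: qe)
    moreover have "Suc (length (xs @ ys)) * Suc (card V) \<le> length (xs' @ ys') * Suc (card V)"
      using that(2) by (intro mult_le_mono1) simp
    moreover have "length xs \<le> card V" using glen[of xs ys] q(1) by (simp add: qe)
    ultimately show False by (simp add: \<Phi>_def)
  qed
  have mx2: False if "good (xs', ys')" "length (xs' @ ys') = length (xs @ ys)" "length xs' > length xs" for xs' ys'
    using q(2)[OF that(1)] that by (simp add: qe \<Phi>_def)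
  define m where "m = length xs"
  have inV': "set (xs @ ys) \<subseteq> V" using glen[of xs ys] q(1) by (simp add: qe)
  have px: "graph_path E xs" using pxy by (simp add: graph_path_append_iff)
  have dx: "distinct xs" using px by (simp add: graph_path_def)
  \<comment> \<open>heads of Hamiltonian paths of the prefix\<close>
  \<comment> \<open>The vertices that start a Hamiltonian path of the prefix with the same last vertex. Such a path can
    take the place of \<open>xs\<close>, so the maximality of \<open>(xs, ys)\<close> confines the neighbours of its start to \<open>xs\<close>.\<close>
  define R where "R = (\<lambda>x. \<exists>zs. zs \<noteq> [] \<and> graph_path E zs \<and> set zs = set xs \<and> last zs = last xs \<and> hd zs = x)"
  have RN: "{y. E x y} \<subseteq> set xs" if Rx: "R x" for x
  proof
    fix y assume "y \<in> {y. E x y}"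
    then have xy: "E x y" by simp
    obtain zs where zs: "zs \<noteq> []" "graph_path E zs" "set zs = set xs" "last zs = last xs" "hd zs = x"
      using Rx by (auto simp: R_def)
    have lz: "length zs = length xs" using zs dx by (metis distinct_card graph_path_def)
    have pzy: "graph_path E (zs @ ys)" using pxy zs xsne by (auto simp: graph_path_append_iff)
    show "y \<in> set xs"
    proof (rule ccontr)
      assume ny: "y \<notin> set xs"
      show False
      proof (cases "y \<in> set ys")
        case False
        have "graph_path E ([y, x] @ tl zs @ ys)"
        proof -
          have "graph_path E ([y] @ (zs @ ys))"
            using pzy zs False ny xy sym
            by (subst graph_path_append_iff) (auto simp: hd_append graph_path_def)
          moreover have "[y] @ (zs @ ys) = [y, x] @ tl zs @ ys" using zs by (cases zs) auto
          ultimately show ?thesis by metis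
        qed
        then have "good ([y, x], tl zs @ ys)" using xy sym by (auto simp: good_def)
        moreover have "length ([y, x] @ (tl zs @ ys)) > length (xs @ ys)" using lz zs by (cases zs) auto
        ultimately show False by (rule mx1)
      next
        case True
        then obtain as bs where ab: "ys = as @ y # bs" by (metis split_list)
        have "good (zs @ as @ [y], bs)" using pzy zs xy by (auto simp: good_def ab)
        moreover have "length ((zs @ as @ [y]) @ bs) = length (xs @ ys)" using lz ab by simp
        moreover have "length (zs @ as @ [y]) > length xs" using lz by simp
        ultimately show False by (rule mx2)
      qed
    qed
  qed
  have RV: "x \<in> V" if "R x" for x
    using that inV' unfolding R_def by (metis UnCI hd_in_set set_append subsetD)
  have R0: "R (hd xs)" using px xsne by (auto simp: R_def)
  have lenx: "3 \<le> m \<and> m < k"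
  proof -
    have s: "{y. E (hd xs) y} \<subseteq> set xs - {hd xs}" using RN[OF R0] irr by auto
    have "card {y. E (hd xs) y} \<le> card (set xs - {hd xs})" by (rule card_mono[OF _ s]) simp
    also have "\<dots> = m - 1" using xsne dx by (simp add: m_def distinct_card)
    finally have "k \<le> 2 * (m - 1)" using deg[OF RV[OF R0]] by linarith
    then have "3 \<le> m" using k by linarith
    moreover have "graph_cycle E xs" using px ce sym \<open>3 \<le> m\<close> by (auto simp: graph_cycle_def m_def)
    ultimately show ?thesis using cyc by (auto simp: m_def)
  qed
  \<comment> \<open>Downward induction on the position: the last but one vertex qualifies by running backwards over the
    closing edge, and from \<open>xs ! Suc i\<close> one gets to \<open>xs ! i\<close> by joining the reversed initial part to the
    rest, which the degrees of the two facing ends allow.\<close>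
  have Ri: "R (xs ! i)" if "i < m - 1" for i
    using that
  proof (induction "m - 2 - i" arbitrary: i)
    case 0
    then have i: "i = m - 2" by simp
    define zs where "zs = rev (butlast xs) @ [last xs]"
    have x: "xs = butlast xs @ [last xs]" using xsne by simp
    have bn: "butlast xs \<noteq> []" using lenx by (cases xs) (auto simp: m_def)
    have "hd (butlast xs) = hd xs" using bn by (cases xs) auto
    have g: "graph_path E (butlast xs @ [last xs])" using px x by simp
    have "graph_path E zs" unfolding zs_def
      using g[unfolded graph_path_append_iff] bn ce \<open>hd (butlast xs) = hd xs\<close>
      by (auto simp: graph_path_append_iff graph_path_rev[OF E(1)] last_rev)
    moreover have "set zs = set xs" using xsne by (metis append_butlast_last_id set_append set_rev zs_def)
    moreover have "hd zs = xs ! i" using bn i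
      by (simp add: zs_def hd_append hd_rev last_conv_nth m_def numeral_2_eq_2)
      (metis bn diff_less length_butlast length_greater_0_conv nth_butlast zero_less_Suc diff_Suc_eq_diff_pred diff_Suc_1' One_nat_def)
    ultimately show ?case unfolding R_def by (intro exI[of _ zs]) (auto simp: zs_def)
  next
    case (Suc d)
    then have i: "Suc i < m - 1" and d: "d = m - 2 - Suc i" by auto
    have Rs: "R (xs ! Suc i)" by (rule Suc.hyps(1)[OF d i])
    define us ws where "us = rev (take (Suc i) xs)" and "ws = drop (Suc i) xs"
    have ne: "us \<noteq> []" "ws \<noteq> []" using i by (auto simp: us_def ws_def m_def)
    have g: "graph_path E (take (Suc i) xs @ drop (Suc i) xs)" using px by simp
    have gs: "graph_path E us" "graph_path E ws" "set us \<inter> set ws = {}"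
      using g[unfolded graph_path_append_iff] by (auto simp: us_def ws_def graph_path_rev[OF E(1)])
    have su: "set (us @ ws) = set xs"
      by (metis append_take_drop_id set_append set_rev us_def ws_def)
    have lu: "length (us @ ws) = m" using i by (simp add: us_def ws_def m_def)
    have lus: "last us = hd xs" using ne by (simp add: us_def last_rev hd_take)
    have hws: "hd ws = xs ! Suc i" using i by (simp add: ws_def hd_drop_conv_nth m_def)
    have hus: "hd us = xs ! i" using i by (simp add: us_def m_def take_Suc_conv_app_nth)
    have lws: "last ws = last xs" using ne by (simp add: ws_def)
    have "length (us @ ws) < card {z. E (last us) z} + card {z. E (hd ws) z}"
      using deg[OF RV[OF R0]] deg[OF RV[OF Rs]] lenx lu by (simp add: lus hws)
    then obtain zs where "graph_path E zs" "set zs = set (us @ ws)" "zs \<noteq> []" "hd zs = hd us" "last zs = last ws"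
      using join_paths_by_crossing[OF E gs(1) ne(1) gs(2) ne(2) gs(3)] RN[OF R0] RN[OF Rs]
      unfolding su lus hws by blast
    then show ?case unfolding R_def su hus lws by blast
  qed
  show ?thesis
  proof (intro exI conjI ballI allI impI)
    show "set xs \<subseteq> V" using inV' by simp
    show "last xs \<in> set xs" using xsne by simp
    show "2 \<le> card (set xs)" "card (set xs) < k" using lenx dx by (auto simp: distinct_card m_def)
    fix x y assume x: "x \<in> set xs - {last xs}" and "E x y"
    then obtain i where i: "i < m" "x = xs ! i" by (auto simp: in_set_conv_nth m_def)
    have "i \<noteq> m - 1" using x i xsne by (auto simp: last_conv_nth m_def)
    then have "R x" using Ri[of i] i by auto
    then show "y \<in> set xs" using RN \<open>E x y\<close> by blast
  qed
qed

section \<open>Counting in families of two set sizes\<close>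

lemma nsets_finite_iff: "finite L \<Longrightarrow> e \<in> [L]\<^bsup>j\<^esup> \<longleftrightarrow> e \<subseteq> L \<and> card e = j"
  by (auto simp: nsets_def finite_subset)

lemma card_nsets_containing:
  assumes "finite L" "p \<subseteq> L" "card p \<le> j"
  shows "card {e \<in> [L]\<^bsup>j\<^esup>. p \<subseteq> e} = (card L - card p) choose (j - card p)"
proof -
  have fp: "finite p" using assms finite_subset by blast
  have "bij_betw (\<lambda>e. e - p) {e \<in> [L]\<^bsup>j\<^esup>. p \<subseteq> e} ([L - p]\<^bsup>(j - card p)\<^esup>)"
  proof (rule bij_betw_byWitness[where f' = "\<lambda>e. e \<union> p"])
    have "card (e \<union> p) = j" if "e \<subseteq> L - p" "card e = j - card p" for e
    proof -
      have "finite e" "e \<inter> p = {}" using that assms(1) by (auto dest: finite_subset)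
      then show ?thesis using fp that assms(3) by (simp add: card_Un_disjoint)
    qed
    then show "(\<lambda>e. e \<union> p) ` [L - p]\<^bsup>(j - card p)\<^esup> \<subseteq> {e \<in> [L]\<^bsup>j\<^esup>. p \<subseteq> e}"
      using assms by (auto simp: nsets_finite_iff)
  qed (use assms fp in \<open>auto simp: nsets_finite_iff card_Diff_subset\<close>)
  then show ?thesis using assms fp by (simp add: bij_betw_same_card card_Diff_subset)
qed

text \<open>
  Counting incidences between the \<open>j\<close>-sets of \<open>F\<close> and the \<open>i\<close>-sets below them shows that each covered
  \<open>i\<close>-set pays for at most a fixed fraction of a \<open>j\<close>-set. An \<open>i\<close>-set that belongs to \<open>F\<close> lies
  below no \<open>j\<close>-set of \<open>F\<close> and pays for itself, so the larger of the two rates bounds the whole family.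
\<close>
lemma card_mixed_family_le:
  assumes L: "finite L" and F: "F \<subseteq> [L]\<^bsup>i\<^esup> \<union> [L]\<^bsup>j\<^esup>" and ij: "i < j"
    and anti: "\<And>p e. p \<in> F \<Longrightarrow> e \<in> F \<Longrightarrow> card p = i \<Longrightarrow> card e = j \<Longrightarrow> \<not> p \<subseteq> e"
  shows "card F * (j choose i) \<le>
    card {p \<in> [L]\<^bsup>i\<^esup>. \<exists>e\<in>F. p \<subseteq> e} * max (j choose i) ((card L - i) choose (j - i))"
proof -
  define R A B where "R = F \<inter> [L]\<^bsup>i\<^esup>" and "A = F \<inter> [L]\<^bsup>j\<^esup>" and "B = {p \<in> [L]\<^bsup>i\<^esup>. \<exists>e\<in>A. p \<subseteq> e}"
  let ?M = "max (j choose i) ((card L - i) choose (j - i))"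
  have fin: "finite R" "finite A" "finite B" using L by (auto simp: R_def A_def B_def finite_imp_finite_nsets)
  have FRA: "F = R \<union> A" "R \<inter> A = {}" using F ij by (auto simp: R_def A_def nsets_def)
  have RB: "R \<inter> B = {}"
    using anti L by (fastforce simp: R_def A_def B_def nsets_finite_iff)
  have sh: "R \<union> B \<subseteq> {p \<in> [L]\<^bsup>i\<^esup>. \<exists>e\<in>F. p \<subseteq> e}" by (auto simp: R_def A_def B_def)
  have "(\<Sum>e\<in>A. card {p \<in> B. p \<subseteq> e}) = (\<Sum>p\<in>B. card {e \<in> A. p \<subseteq> e})"
    by (rule sum_multicount_gen) (use fin in auto)
  moreover have "card {p \<in> B. p \<subseteq> e} = j choose i" if "e \<in> A" for e
  proof -
    have "finite e" "card e = j" "e \<subseteq> L" using that by (auto simp: A_def nsets_def)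
    then have "{p \<in> B. p \<subseteq> e} = [e]\<^bsup>i\<^esup>" using that L
      by (auto simp: B_def nsets_def)
    then show ?thesis using \<open>card e = j\<close> by simp
  qed
  moreover have "card {e \<in> A. p \<subseteq> e} \<le> (card L - i) choose (j - i)" if "p \<in> B" for p
  proof -
    have p: "p \<subseteq> L" "card p = i" using that by (auto simp: B_def nsets_def)
    have "card {e \<in> A. p \<subseteq> e} \<le> card {e \<in> [L]\<^bsup>j\<^esup>. p \<subseteq> e}"
      by (rule card_mono) (use L in \<open>auto simp: A_def finite_imp_finite_nsets\<close>)
    then show ?thesis using card_nsets_containing[OF L p(1)] p ij by simp
  qed
  ultimately have "card A * (j choose i) \<le> (\<Sum>p\<in>B. (card L - i) choose (j - i))"
    by (metis (no_types, lifting) sum.cong sum_constant sum_mono of_nat_id)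
  then have "card A * (j choose i) \<le> card B * ?M" 
    by (simp, meson le_trans max.cobounded2 mult_le_mono2)
  moreover have "card R * (j choose i) \<le> card R * ?M" by simp
  ultimately have "(card R + card A) * (j choose i) \<le> (card R + card B) * ?M"
    unfolding add_mult_distrib by (rule add_le_mono[rotated])
  moreover have "card F = card R + card A" using FRA fin by (simp add: card_Un_disjoint)
  moreover have "card R + card B \<le> card {p \<in> [L]\<^bsup>i\<^esup>. \<exists>e\<in>F. p \<subseteq> e}"
    using card_mono[OF _ sh] L RB fin by (simp add: card_Un_disjoint finite_imp_finite_nsets)
  ultimately show ?thesis by (metis (no_types, lifting) le_trans mult_le_mono1)
qed

text \<open>Each of the \<open>j\<close> factors \<open>t - i\<close> of the falling factorial doubles to at most \<open>2 * t - i\<close>.\<close>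
lemma choose_mult_power2_le: "(t choose j) * 2 ^ j \<le> (2 * t) choose j"
proof (induction j)
  case (Suc j)
  have step: "(n choose Suc j) * Suc j = (n - j) * (n choose j)" for n
    using binomial_absorption[of j n] binomial_absorb_comp[of n j] by (simp only: mult.commute)
  have "(t choose Suc j) * 2 ^ Suc j * Suc j = 2 ^ Suc j * ((t choose Suc j) * Suc j)"
    by (simp only: ac_simps)
  also have "\<dots> = 2 ^ Suc j * ((t - j) * (t choose j))" by (simp only: step)
  also have "\<dots> = (2 * t - 2 * j) * ((t choose j) * 2 ^ j)" by (simp add: diff_mult_distrib2)
  also have "\<dots> \<le> (2 * t - j) * ((2 * t) choose j)" using Suc by (intro mult_le_mono) auto
  also have "\<dots> = ((2 * t) choose Suc j) * Suc j"
    by (simp only: step)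
  finally show ?case by (metis mult_le_cancel2 zero_less_Suc)
qed simp

lemma two_mult_choose_two: "2 * (m choose 2) = m * (m - 1)"
proof -
  have "even (m * (m - 1))" by (cases m) auto
  then show ?thesis by (simp add: choose_two)
qed

context
  fixes N r :: nat
  assumes r: "3 \<le> r" and N: "r + 2 \<le> N"
begin

lemma choose_reduce: "(N choose r) * (r * (r - 1)) = N * (N - 1) * ((N - 2) choose (r - 2))"
proof -
  have "(N choose r) * (r choose 2) = (N choose 2) * ((N - 2) choose (r - 2))"
    using choose_mult[of 2 r N] r N by simp
  then have "(N choose r) * (2 * (r choose 2)) = 2 * (N choose 2) * ((N - 2) choose (r - 2))" by simp
  then show ?thesis by (simp only: two_mult_choose_two)
qed

text \<open>
  By symmetry \<open>r choose 2\<close> is \<open>r choose (r - 2)\<close>, and \<open>N \<ge> r + 2\<close> permits raising the upper argument.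
  In effect a complete piece of \<open>r\<close>-sets on \<open>N\<close> vertices is at least as large as a complete graph there.
\<close>
lemma choose_two_le_reduced: "r choose 2 \<le> (N - 2) choose (r - 2)"
proof -
  have "r choose 2 = r choose (r - 2)" using r by (intro binomial_symmetric) simp
  also have "\<dots> \<le> (N - 2) choose (r - 2)" using N by (intro binomial_right_mono) simp
  finally show ?thesis .
qed

text \<open>
  The cost of removing all but one vertex of a set with \<open>m\<close> elements. Both rates of
  \<open>card_mixed_family_le\<close> are at most \<open>N - 2 choose (r - 2)\<close>, and \<open>b / (m - 1)\<close> is at most \<open>m / 2\<close>; at
  \<open>m = N\<close> with all pairs covered this is exactly the allowed cost.
\<close>
lemma small_set_count_le:
  assumes m: "2 \<le> m" "m \<le> N" and b: "b \<le> m choose 2"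
    and f: "f * (r choose 2) \<le> b * max (r choose 2) ((m - 2) choose (r - 2))"
  shows "f * (N - 1) \<le> (m - 1) * (N choose r)"
    and "f * (N - 1) = (m - 1) * (N choose r) \<Longrightarrow> m = N \<and> b = N choose 2"
proof -
  define D where "D = (N - 2) choose (r - 2)"
  have D: "0 < D" using r N by (simp add: D_def)
  have rr: "0 < r * (r - 1)" using r by simp
  have "max (r choose 2) ((m - 2) choose (r - 2)) \<le> D"
    using choose_two_le_reduced m by (simp add: D_def binomial_right_mono)
  then have "f * (r choose 2) \<le> b * D" using f by (meson le_trans mult_le_mono2)
  then have "f * (2 * (r choose 2)) \<le> 2 * b * D" by simp
  then have "f * (r * (r - 1)) * (N - 1) \<le> 2 * b * D * (N - 1)"
    unfolding two_mult_choose_two by (rule mult_le_mono1)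
  moreover have b2: "2 * b \<le> m * (m - 1)" using b two_mult_choose_two[of m] by linarith
  moreover have mm: "m * (m - 1) \<le> N * (m - 1)" using m by simp
  moreover have "(m - 1) * (N choose r) * (r * (r - 1)) = (m - 1) * (N * (N - 1) * D)"
    using choose_reduce by (simp add: D_def)
  then have eq: "(m - 1) * (N choose r) * (r * (r - 1)) = N * (m - 1) * (D * (N - 1))"
    by (simp only: ac_simps)
  moreover have fb: "f * (N - 1) * (r * (r - 1)) \<le> 2 * b * (D * (N - 1))"
    using calculation(1) by (simp add: ac_simps)
  moreover have "2 * b * (D * (N - 1)) \<le> N * (m - 1) * (D * (N - 1))"
    using b2 mm by (intro mult_le_mono1) linarith
  ultimately have "f * (N - 1) * (r * (r - 1)) \<le> (m - 1) * (N choose r) * (r * (r - 1))" by linarith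
  then show "f * (N - 1) \<le> (m - 1) * (N choose r)" using rr by (metis mult_le_cancel2)
  assume "f * (N - 1) = (m - 1) * (N choose r)"
  then have "N * (m - 1) * (D * (N - 1)) \<le> 2 * b * (D * (N - 1))" using fb eq by metis
  moreover have "0 < D * (N - 1)" using D m by simp
  ultimately have "N * (m - 1) \<le> 2 * b" by (metis mult_le_cancel2)
  then have e: "2 * b = m * (m - 1)" "N * (m - 1) = m * (m - 1)" using b2 mm by linarith+
  then have "m = N" using m by simp
  moreover have "b = m choose 2" using e two_mult_choose_two[of m] by linarith
  ultimately show "m = N \<and> b = N choose 2" by simp
qed

text \<open>
  The cost of removing a vertex of degree \<open>d\<close>, where the hypothesis on \<open>f\<close> is \<open>card_mixed_family_le\<close> for
  the link of the vertex. Halving the upper argument of a binomial coefficient divides it by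
  at least \<open>2 ^ (r - 2)\<close>, and \<open>r \<le> 2 ^ (r - 1)\<close>. Degree at most 1 is singled out because in that case
  the vertex does not lie on a cycle and only strictness of the count excludes equality.
\<close>
lemma low_degree_count_le:
  assumes d: "2 * d \<le> N" and b: "b \<le> d"
    and f: "f * (r - 1) \<le> b * max (r - 1) ((d - 1) choose (r - 2))"
  shows "f * (N - 1) \<le> N choose r" and "d \<le> 1 \<Longrightarrow> f * (N - 1) < N choose r"
proof -
  define D where "D = (N - 2) choose (r - 2)"
  have D: "0 < D" using r N by (simp add: D_def)
  have rr: "0 < r * (r - 1)" using r by simp
  have "r * (r - 1) \<le> 2 * D" using choose_two_le_reduced two_mult_choose_two[of r] by (simp add: D_def)
  moreover have "r * ((d - 1) choose (r - 2)) \<le> 2 * D"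
  proof -
    have "r \<le> 2 * 2 ^ (r - 2)"
    proof -
      have "n + 3 \<le> 2 * 2 ^ (n + 1)" for n :: nat by (induction n) auto
      from this[of "r - 3"] show ?thesis using r by (simp add: numeral_3_eq_3 Suc_diff_Suc numeral_2_eq_2)
    qed
    then have "r * ((d - 1) choose (r - 2)) \<le> 2 * (((d - 1) choose (r - 2)) * 2 ^ (r - 2))"
      by (metis mult.assoc mult.commute mult_le_mono1)
    also have "((d - 1) choose (r - 2)) * 2 ^ (r - 2) \<le> (2 * (d - 1)) choose (r - 2)"
      by (rule choose_mult_power2_le)
    also have "\<dots> \<le> D" unfolding D_def using d by (intro binomial_right_mono) simp
    finally show ?thesis by simp
  qed
  ultimately have mx: "r * max (r - 1) ((d - 1) choose (r - 2)) \<le> 2 * D" by (simp add: max_def)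
  have "f * (r * (r - 1)) = r * (f * (r - 1))" by simp
  also have "\<dots> \<le> r * (b * max (r - 1) ((d - 1) choose (r - 2)))" using f by simp
  also have "\<dots> = b * (r * max (r - 1) ((d - 1) choose (r - 2)))" by simp
  also have "\<dots> \<le> d * (2 * D)" using b mx by (rule mult_le_mono)
  finally have "f * (r * (r - 1)) * (N - 1) \<le> d * (2 * D) * (N - 1)" by (rule mult_le_mono1)
  then have f1: "f * (N - 1) * (r * (r - 1)) \<le> 2 * d * (D * (N - 1))" by (simp add: ac_simps)
  have eq: "(N choose r) * (r * (r - 1)) = N * (D * (N - 1))" using choose_reduce by (simp add: D_def)
  have "2 * d * (D * (N - 1)) \<le> N * (D * (N - 1))" using d by (rule mult_le_mono1)
  then have "f * (N - 1) * (r * (r - 1)) \<le> (N choose r) * (r * (r - 1))" using f1 eq by linarith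
  then show "f * (N - 1) \<le> N choose r" using rr by (metis mult_le_cancel2)
  assume "d \<le> 1"
  then have "2 * d * (D * (N - 1)) < N * (D * (N - 1))" using D N r by (intro mult_less_mono1) auto
  then have "f * (N - 1) * (r * (r - 1)) < (N choose r) * (r * (r - 1))" using f1 eq by linarith
  then show "f * (N - 1) < N choose r" by (metis mult_less_cancel2)
qed

end

section \<open>Families without long cycles in their shadow graph\<close>

definition shadow_adj :: "'a set set \<Rightarrow> 'a \<Rightarrow> 'a \<Rightarrow> bool" where
  "shadow_adj F x y \<longleftrightarrow> x \<noteq> y \<and> (\<exists>e\<in>F. {x, y} \<subseteq> e)"

lemma shadow_adj_symp: "symp (shadow_adj F)"
  by (auto simp: shadow_adj_def symp_def)

lemma shadow_adj_sym: "shadow_adj F x y \<Longrightarrow> shadow_adj F y x"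
  by (auto simp: shadow_adj_def)

lemma shadow_adj_irreflp: "irreflp (shadow_adj F)"
  by (auto simp: shadow_adj_def irreflp_def)

lemma shadow_adj_mono: "shadow_adj F x y \<Longrightarrow> F \<subseteq> F' \<Longrightarrow> shadow_adj F' x y"
  by (auto simp: shadow_adj_def)

lemma graph_path_mono: "graph_path E xs \<Longrightarrow> (\<And>x y. E x y \<Longrightarrow> E' x y) \<Longrightarrow> graph_path E' xs"
  unfolding graph_path_def by (auto elim: successively_mono)

lemma graph_cycle_mono: "graph_cycle E xs \<Longrightarrow> (\<And>x y. E x y \<Longrightarrow> E' x y) \<Longrightarrow> graph_cycle E' xs"
  unfolding graph_cycle_def by (auto elim: graph_path_mono)

lemma graph_path_if_pairwise:
  "distinct xs \<Longrightarrow> (\<And>x y. x \<in> set xs \<Longrightarrow> y \<in> set xs \<Longrightarrow> x \<noteq> y \<Longrightarrow> E x y) \<Longrightarrow> graph_path E xs"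
  unfolding graph_path_def successively_conv_nth by (auto simp: nth_eq_iff_index_eq)

text \<open>
  The extremal families, built by attaching cliques \<open>W\<close> with \<open>N\<close> vertices at single vertices. The
  members \<open>K\<close> inside a clique are only required to cover all its pairs and to be \<open>c\<close> in number; this
  admits both the complete family of \<open>r\<close>-sets and, when it has the same size, the complete graph.
\<close>
inductive clique_tree :: "nat \<Rightarrow> nat \<Rightarrow> 'a set \<Rightarrow> 'a set set \<Rightarrow> bool" for N c where
  single: "clique_tree N c {v} {}"
| glue: "clique_tree N c V F \<Longrightarrow> finite W \<Longrightarrow> card W = N \<Longrightarrow> V \<inter> W = {x} \<Longrightarrow> K \<subseteq> Pow W \<Longrightarrow>
    (\<And>y z. y \<in> W \<Longrightarrow> z \<in> W \<Longrightarrow> y \<noteq> z \<Longrightarrow> \<exists>e\<in>K. {y, z} \<subseteq> e) \<Longrightarrow> card K = c \<Longrightarrow>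
    clique_tree N c (V \<union> W) (F \<union> K)"

lemma clique_tree_subset: "clique_tree N c V F \<Longrightarrow> F \<subseteq> Pow V"
  by (induction rule: clique_tree.induct) auto

lemma shadow_adj_glue:
  assumes "K \<subseteq> Pow W" "\<And>y z. y \<in> W \<Longrightarrow> z \<in> W \<Longrightarrow> y \<noteq> z \<Longrightarrow> \<exists>e\<in>K. {y, z} \<subseteq> e"
  shows "shadow_adj (F \<union> K) a b \<longleftrightarrow> shadow_adj F a b \<or> a \<noteq> b \<and> a \<in> W \<and> b \<in> W"
proof
  assume "shadow_adj (F \<union> K) a b"
  then show "shadow_adj F a b \<or> a \<noteq> b \<and> a \<in> W \<and> b \<in> W" using assms(1) by (auto simp: shadow_adj_def)
next
  assume "shadow_adj F a b \<or> a \<noteq> b \<and> a \<in> W \<and> b \<in> W"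
  then show "shadow_adj (F \<union> K) a b" using assms(2)[of a b] by (auto simp: shadow_adj_def)
qed

lemma clique_tree_long_path:
  assumes "clique_tree N c V F" "2 \<le> N" "u \<in> V" "v \<in> V" "u \<noteq> v"
  shows "\<exists>xs. xs \<noteq> [] \<and> graph_path (shadow_adj F) xs \<and> set xs \<subseteq> V \<and> N \<le> length xs \<and> hd xs = u \<and> last xs = v"
  using assms
proof (induction arbitrary: u v rule: clique_tree.induct)
  case (single v')
  then show ?case by simp
next
  case (glue V F W x K)
  have adj: "shadow_adj (F \<union> K) a b \<longleftrightarrow> shadow_adj F a b \<or> a \<noteq> b \<and> a \<in> W \<and> b \<in> W" for a b
    by (rule shadow_adj_glue[OF glue.hyps(5)]) (rule glue.hyps(6))
  have xW: "x \<in> V" "x \<in> W" using glue.hyps(4) by auto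
  have up: "graph_path (shadow_adj (F \<union> K)) xs" if "graph_path (shadow_adj F) xs" for xs
    using that by (rule graph_path_mono) (auto simp: adj)
  consider (VV) "u \<in> V" "v \<in> V" | (WW) "u \<in> W" "v \<in> W"
    | (VW) "u \<in> V" "u \<noteq> x" "v \<in> W - V" | (WV) "v \<in> V" "v \<noteq> x" "u \<in> W - V"
    using glue.prems glue.hyps(4) by blast
  then show ?case
  proof cases
    case VV
    then show ?thesis using glue.IH[OF glue.prems(1) VV \<open>u \<noteq> v\<close>] up by blast
  next
    case WW
    obtain ys where ys: "set ys = W - {u, v}" "distinct ys"
      using finite_distinct_list[of "W - {u, v}"] glue.hyps(2) by auto
    have d: "distinct (u # ys @ [v])" using ys \<open>u \<noteq> v\<close> by auto
    have s: "set (u # ys @ [v]) = W" using ys WW by auto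
    have "length (u # ys @ [v]) = N" using distinct_card[OF d] s glue.hyps(3) by simp
    moreover have "graph_path (shadow_adj (F \<union> K)) (u # ys @ [v])"
    proof (rule graph_path_if_pairwise[OF d])
      fix p q assume pq: "p \<in> set (u # ys @ [v])" "q \<in> set (u # ys @ [v])" "p \<noteq> q"
      have "p \<in> W" "q \<in> W" using pq(1,2) unfolding s .
      then show "shadow_adj (F \<union> K) p q" using pq(3) adj by blast
    qed
    ultimately show ?thesis using s by (intro exI[of _ "u # ys @ [v]"]) auto
  next
    case VW
    obtain xs where xs: "xs \<noteq> []" "graph_path (shadow_adj F) xs" "set xs \<subseteq> V" "N \<le> length xs" "hd xs = u" "last xs = x"
      using glue.IH[OF glue.prems(1) VW(1) xW(1) VW(2)] by blast
    have "x \<noteq> v" using VW xW by auto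
    then have "graph_path (shadow_adj (F \<union> K)) (xs @ [v])"
      using up[OF xs(2)] xs VW xW by (auto simp: graph_path_append_iff adj) (auto simp: graph_path_def)
    then show ?thesis using xs VW by (intro exI[of _ "xs @ [v]"]) auto
  next
    case WV
    obtain xs where xs: "xs \<noteq> []" "graph_path (shadow_adj F) xs" "set xs \<subseteq> V" "N \<le> length xs" "hd xs = x" "last xs = v"
      using glue.IH[OF glue.prems(1) xW(1) WV(1)] WV(2) by blast
    have "x \<noteq> u" using WV xW by auto
    then have "graph_path (shadow_adj (F \<union> K)) ([u] @ xs)"
      using up[OF xs(2)] xs WV xW by (subst graph_path_append_iff) (auto simp: adj graph_path_def)
    then show ?thesis using xs WV by (intro exI[of _ "[u] @ xs"]) auto
  qed
qed

text \<open>This and the next lemma make the shadow graph of a clique tree rigid under the exchange of an edge.\<close>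
lemma clique_tree_common_neighbours:
  assumes "clique_tree N c V F" "4 \<le> N" "shadow_adj F a b"
  shows "\<exists>z w. z \<noteq> w \<and> shadow_adj F a z \<and> shadow_adj F b z \<and> shadow_adj F a w \<and> shadow_adj F b w"
  using assms
proof (induction rule: clique_tree.induct)
  case (single v)
  then show ?case by (simp add: shadow_adj_def)
next
  case (glue V F W x K)
  have adj: "shadow_adj (F \<union> K) a b \<longleftrightarrow> shadow_adj F a b \<or> a \<noteq> b \<and> a \<in> W \<and> b \<in> W" for a b
    by (rule shadow_adj_glue[OF glue.hyps(5)]) (rule glue.hyps(6))
  show ?case
  proof (cases "shadow_adj F a b")
    case True
    obtain z w where zw: "z \<noteq> w" "shadow_adj F a z" "shadow_adj F b z" "shadow_adj F a w" "shadow_adj F b w"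
      using glue.IH[OF glue.prems(1) True] by blast
    then show ?thesis by (intro exI[of _ z] exI[of _ w]) (simp add: adj)
  next
    case False
    then have ab: "a \<noteq> b" "a \<in> W" "b \<in> W" using glue.prems(2) adj by auto
    have "2 \<le> card (W - {a, b})" using ab glue.hyps(2,3) glue.prems(1) by simp
    then obtain T where "T \<subseteq> W - {a, b}" "card T = 2" by (meson obtain_subset_with_card_n)
    then obtain z w where "z \<noteq> w" "z \<in> W - {a, b}" "w \<in> W - {a, b}" by (auto simp: card_2_iff)
    then show ?thesis using ab by (intro exI[of _ z] exI[of _ w]) (auto simp: adj)
  qed
qed

lemma clique_tree_adjacent_if_common:
  assumes "clique_tree N c V F" "a \<noteq> b" "z \<noteq> w" "shadow_adj F a z" "shadow_adj F b z" "shadow_adj F a w" "shadow_adj F b w"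
  shows "shadow_adj F a b"
  using assms
proof (induction rule: clique_tree.induct)
  case (single v)
  then show ?case by (simp add: shadow_adj_def)
next
  case (glue V F W x K)
  have adj: "shadow_adj (F \<union> K) a b \<longleftrightarrow> shadow_adj F a b \<or> a \<noteq> b \<and> a \<in> W \<and> b \<in> W" for a b
    by (rule shadow_adj_glue[OF glue.hyps(5)]) (rule glue.hyps(6))
  have "F \<subseteq> Pow V" using glue.hyps(1) by (rule clique_tree_subset)
  then have V: "p \<in> V \<and> q \<in> V" if "shadow_adj F p q" for p q using that by (auto simp: shadow_adj_def)
  have x: "p = q" if "p \<in> V" "p \<in> W" "q \<in> V" "q \<in> W" for p q
    using that glue.hyps(4) by (metis IntI singletonD)
  have VV: "shadow_adj F p q" if "shadow_adj (F \<union> K) p q" "p \<in> V" "q \<in> V" for p q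
    using that x adj by blast
  have nW: "p \<in> V \<and> q \<in> V" if "shadow_adj (F \<union> K) p q \<or> shadow_adj (F \<union> K) q p" "p \<notin> W" for p q
    using that V adj by blast
  show ?case
  proof (cases "a \<in> W \<and> b \<in> W")
    case True
    then show ?thesis using glue.prems(1) by (simp add: adj)
  next
    case False
    then have "z \<in> V \<and> w \<in> V \<and> (a \<in> V \<or> b \<in> V)" using nW glue.prems by blast
    moreover from this have "z \<notin> W \<or> w \<notin> W" using x glue.prems(2) by blast
    ultimately have "a \<in> V" "b \<in> V" "z \<in> V" "w \<in> V" using nW glue.prems by blast+
    then have "shadow_adj F a b" using glue.prems by (intro glue.IH) (auto intro: VV)
    then show ?thesis by (simp add: adj)
  qed
qed

lemma finite_shadow_adj: "finite V \<Longrightarrow> F \<subseteq> Pow V \<Longrightarrow> finite {y. shadow_adj F x y}"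
  by (rule finite_subset[of _ V]) (auto simp: shadow_adj_def)

text \<open>
  The bound for families of 2-sets and \<open>r\<close>-sets. The antichain condition lets each pair of the shadow
  graph be charged either to itself or to the \<open>r\<close>-sets around it, but not to both.
\<close>
theorem mixed_family_bound:
  fixes V :: "'a set" and F :: "'a set set"
  assumes r: "3 \<le> r" and k: "r + 3 \<le> k"
    and "finite V" "V \<noteq> {}" "F \<subseteq> [V]\<^bsup>2\<^esup> \<union> [V]\<^bsup>r\<^esup>"
    and "\<And>p e. p \<in> F \<Longrightarrow> e \<in> F \<Longrightarrow> card p = 2 \<Longrightarrow> card e = r \<Longrightarrow> \<not> p \<subseteq> e"
    and "\<And>xs. graph_cycle (shadow_adj F) xs \<Longrightarrow> length xs < k"
  shows "card F * (k - 2) \<le> (card V - 1) * ((k - 1) choose r) \<and>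
    (card F * (k - 2) = (card V - 1) * ((k - 1) choose r) \<longrightarrow>
      clique_tree (k - 1) ((k - 1) choose r) V F)"
  using assms(3-)
proof (induction "card V" arbitrary: V F rule: less_induct)
  case less
  note finV = less.prems(1) and neV = less.prems(2) and F = less.prems(3)
    and anti = less.prems(4) and cyc = less.prems(5)
  define N C where "N = k - 1" and "C = N choose r"
  have Nk: "k - 2 = N - 1" "r + 2 \<le> N" using k by (auto simp: N_def)
  have FP: "F \<subseteq> Pow V" using F by (auto simp: nsets_def)
  have finF: "finite F" using finite_subset[OF F] finV by (simp add: finite_imp_finite_nsets)
  have IH: "card F' * (N - 1) \<le> (card V' - 1) * C \<and>
      (card F' * (N - 1) = (card V' - 1) * C \<longrightarrow> clique_tree N C V' F')"
    if "V' \<subset> V" "V' \<noteq> {}" "F' \<subseteq> F" "F' \<subseteq> Pow V'" for V' F'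
  proof -
    have "graph_cycle (shadow_adj F) xs" if "graph_cycle (shadow_adj F') xs" for xs
      using that by (rule graph_cycle_mono) (rule shadow_adj_mono[OF _ \<open>F' \<subseteq> F\<close>])
    moreover have "F' \<subseteq> [V']\<^bsup>2\<^esup> \<union> [V']\<^bsup>r\<^esup>" using that(3,4) F by (auto simp: nsets_def)
    moreover have "card V' < card V" using that finV by (simp add: psubset_card_mono)
    moreover have "finite V'" using that(1) finV finite_subset by blast
    moreover have "\<not> p \<subseteq> e" if "p \<in> F'" "e \<in> F'" "card p = 2" "card e = r" for p e
      using that anti \<open>F' \<subseteq> F\<close> by blast
    ultimately show ?thesis
      using less.hyps[of V' F'] that(2) cyc unfolding N_def[symmetric] C_def[symmetric] Nk(1) by simp
  qed
  have goal: "card F * (N - 1) \<le> (card V - 1) * C \<and>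
    (card F * (N - 1) = (card V - 1) * C \<longrightarrow> clique_tree N C V F)"
  proof (cases "\<exists>v\<in>V. 2 * card {y. shadow_adj F v y} \<le> N")
    case True
    then obtain v where v: "v \<in> V" and dv: "2 * card {y. shadow_adj F v y} \<le> N" by blast
    show ?thesis
    proof (cases "V = {v}")
      case True
      have "[V]\<^bsup>2\<^esup> = {}" "[V]\<^bsup>r\<^esup> = {}" using True r by (auto intro!: nsets_eq_empty)
      then have "F = {}" using F by auto
      then show ?thesis using True by (auto intro: clique_tree.single)
    next
      case False
      define F0 F1 where "F0 = {e \<in> F. v \<notin> e}" and "F1 = {e \<in> F. v \<in> e}"
      define Nv where "Nv = {y. shadow_adj F v y}"
      define Lk where "Lk = (\<lambda>e. e - {v}) ` F1"
      have finN: "finite Nv" unfolding Nv_def by (rule finite_shadow_adj[OF finV FP])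
      have cF: "card F = card F0 + card F1"
      proof -
        have "F = F0 \<union> F1" "F0 \<inter> F1 = {}" by (auto simp: F0_def F1_def)
        then show ?thesis using finF by (metis card_Un_disjoint finite_Un)
      qed
      have "inj_on (\<lambda>e. e - {v}) F1" by (auto simp: inj_on_def F1_def)
      then have cLk: "card Lk = card F1" unfolding Lk_def by (rule card_image)
      have Lk: "Lk \<subseteq> [Nv]\<^bsup>1\<^esup> \<union> [Nv]\<^bsup>(r-1)\<^esup>"
      proof
        fix l assume "l \<in> Lk"
        then obtain e where e: "e \<in> F" "v \<in> e" "l = e - {v}" by (auto simp: Lk_def F1_def)
        have "l \<subseteq> Nv" using e by (auto simp: Nv_def shadow_adj_def)
        moreover have "finite e" "card e = 2 \<or> card e = r" using e F by (auto simp: nsets_def)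
        ultimately show "l \<in> [Nv]\<^bsup>1\<^esup> \<union> [Nv]\<^bsup>(r-1)\<^esup>" using e by (auto simp: nsets_def)
      qed
      have antiL: "\<not> p \<subseteq> e" if pe: "p \<in> Lk" "e \<in> Lk" "card p = 1" "card e = r - 1" for p e
      proof
        assume "p \<subseteq> e"
        obtain p' e' where p': "p' \<in> F" "v \<in> p'" "p = p' - {v}" and e': "e' \<in> F" "v \<in> e'" "e = e' - {v}"
          using pe by (auto simp: Lk_def F1_def)
        have "card p' = 2" "card e' = r" using pe(3,4) p' e' r by (auto simp: card_Diff_singleton_if)
        moreover have "p' \<subseteq> e'" using \<open>p \<subseteq> e\<close> p' e' by auto
        ultimately show False using anti p' e' by blast
      qed
      have bl: "card {p \<in> [Nv]\<^bsup>1\<^esup>. \<exists>e\<in>Lk. p \<subseteq> e} \<le> card Nv"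
      proof -
        have "card {p \<in> [Nv]\<^bsup>1\<^esup>. \<exists>e\<in>Lk. p \<subseteq> e} \<le> card ([Nv]\<^bsup>1\<^esup>)"
          by (rule card_mono) (use finN in \<open>auto simp: finite_imp_finite_nsets\<close>)
        then show ?thesis by simp
      qed
      \<comment> \<open>The members at \<open>v\<close>, with \<open>v\<close> taken out, are singletons and \<open>(r - 1)\<close>-sets of neighbours of \<open>v\<close>.\<close>
      have cnt: "card F1 * (r - 1) \<le>
          card {p \<in> [Nv]\<^bsup>1\<^esup>. \<exists>e\<in>Lk. p \<subseteq> e} * max (r - 1) ((card Nv - 1) choose (r - 2))"
        using card_mixed_family_le[OF finN Lk _ antiL] r unfolding cLk
        by (simp add: numeral_2_eq_2)
      have dN: "2 * card Nv \<le> N" using dv by (simp add: Nv_def)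
      note low = low_degree_count_le[OF r Nk(2) dN bl cnt, folded C_def]
      have sub: "V - {v} \<subset> V" "V - {v} \<noteq> {}" "F0 \<subseteq> F" "F0 \<subseteq> Pow (V - {v})"
        using v False FP by (auto simp: F0_def)
      note ih = IH[OF sub]
      have cV: "card V - 1 = Suc (card (V - {v}) - 1)"
      proof -
        have "card (V - {v}) \<noteq> 0" using sub(2) finV by simp
        then show ?thesis using v finV by (simp add: card_Diff_singleton)
      qed
      have ub: "card F * (N - 1) \<le> (card V - 1) * C"
        using ih low(1) unfolding cF cV by (simp add: add_mult_distrib)
      \<comment> \<open>Equality would make the rest a clique tree and give \<open>v\<close> two neighbours in it, and a long path
        between these closes through \<open>v\<close> to a cycle of length at least \<open>k\<close>.\<close>
      moreover have False if eq: "card F * (N - 1) = (card V - 1) * C"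
      proof -
        have "card F0 * (N - 1) + card F1 * (N - 1) = (card (V - {v}) - 1) * C + C"
          using eq unfolding cF cV by (simp add: add_mult_distrib)
        then have e0: "card F0 * (N - 1) = (card (V - {v}) - 1) * C" and e1: "card F1 * (N - 1) = C"
          using ih low(1) by linarith+
        have ct: "clique_tree N C (V - {v}) F0" using ih e0 by blast
        have "\<not> card Nv \<le> 1" using low(2) e1 by linarith
        then have "2 \<le> card Nv" by simp
        then obtain T where "T \<subseteq> Nv" "card T = 2" by (meson obtain_subset_with_card_n)
        then obtain y z where yz: "y \<noteq> z" "y \<in> Nv" "z \<in> Nv" by (auto simp: card_2_iff)
        have yzV: "y \<in> V - {v}" "z \<in> V - {v}" using yz FP by (auto simp: Nv_def shadow_adj_def)
        obtain xs where xs: "xs \<noteq> []" "graph_path (shadow_adj F0) xs" "set xs \<subseteq> V - {v}" "N \<le> length xs"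
            "hd xs = y" "last xs = z"
          using clique_tree_long_path[OF ct _ yzV yz(1)] Nk r by auto
        have p: "graph_path (shadow_adj F) xs" using xs(2) by (rule graph_path_mono) (rule shadow_adj_mono[OF _ sub(3)])
        have "graph_path (shadow_adj F) ([v] @ xs)"
          using p xs yz(2) by (subst graph_path_append_iff) (auto simp: graph_path_def Nv_def)
        moreover have "shadow_adj F (last ([v] @ xs)) (hd ([v] @ xs))"
          using xs yz(3) shadow_adj_sym by (auto simp: Nv_def)
        moreover have "3 \<le> length ([v] @ xs)" using xs(4) Nk r by simp
        ultimately have "graph_cycle (shadow_adj F) ([v] @ xs)" unfolding graph_cycle_def by blast
        then have "length ([v] @ xs) < k" by (rule cyc)
        then show False using xs(4) by (simp add: N_def)
      qed
      ultimately show ?thesis by blast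
    qed
  next
    case False
    then have mindeg: "k \<le> 2 * card {y. shadow_adj F x y}" if "x \<in> V" for x
      using that by (force simp: N_def not_le)
    have "\<exists>L w. L \<subseteq> V \<and> w \<in> L \<and> 2 \<le> card L \<and> card L < k \<and>
        (\<forall>x\<in>L - {w}. \<forall>y. shadow_adj F x y \<longrightarrow> y \<in> L)"
      by (rule exists_pendant_set[OF finV neV shadow_adj_symp shadow_adj_irreflp])
         (use mindeg cyc k FP in \<open>auto simp: shadow_adj_def\<close>)
    then obtain L w where L: "L \<subseteq> V" "w \<in> L" "2 \<le> card L" "card L < k"
      and pend: "\<And>x y. x \<in> L - {w} \<Longrightarrow> shadow_adj F x y \<Longrightarrow> y \<in> L" by blast
    have finL: "finite L" using L(1) finV finite_subset by blast
    define F0 F1 where "F0 = {e \<in> F. e \<inter> (L - {w}) = {}}" and "F1 = {e \<in> F. e \<inter> (L - {w}) \<noteq> {}}"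
    have FU: "F = F0 \<union> F1" "F0 \<inter> F1 = {}" by (auto simp: F0_def F1_def)
    then have cF: "card F = card F0 + card F1" using finF by (metis card_Un_disjoint finite_Un)
    have F1P: "F1 \<subseteq> Pow L"
    proof
      fix e assume "e \<in> F1"
      then obtain x where x: "e \<in> F" "x \<in> e" "x \<in> L - {w}" by (auto simp: F1_def)
      show "e \<in> Pow L"
      proof
        show "e \<subseteq> L"
        proof
          fix y assume y: "y \<in> e"
          show "y \<in> L"
          proof (cases "y = x")
            case False
            then have "shadow_adj F x y" using x y by (auto simp: shadow_adj_def)
            then show ?thesis using pend x by blast
          qed (use x in simp)
        qed
      qed
    qed
    have F1: "F1 \<subseteq> [L]\<^bsup>2\<^esup> \<union> [L]\<^bsup>r\<^esup>" using F1P F by (auto simp: F1_def nsets_def)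
    have anti1: "\<not> p \<subseteq> e" if "p \<in> F1" "e \<in> F1" "card p = 2" "card e = r" for p e
      using that anti by (auto simp: F1_def)
    define b where "b = card {p \<in> [L]\<^bsup>2\<^esup>. \<exists>e\<in>F1. p \<subseteq> e}"
    have bl: "b \<le> card L choose 2"
    proof -
      have "b \<le> card ([L]\<^bsup>2\<^esup>)" unfolding b_def
        by (rule card_mono) (use finL in \<open>auto simp: finite_imp_finite_nsets\<close>)
      then show ?thesis by simp
    qed
    have cnt: "card F1 * (r choose 2) \<le> b * max (r choose 2) ((card L - 2) choose (r - 2))"
      unfolding b_def by (rule card_mixed_family_le[OF finL F1]) (use r in simp, rule anti1)
    have LN: "card L \<le> N" using L(4) by (simp add: N_def)
    note sm = small_set_count_le[OF r Nk(2) L(3) LN bl cnt, folded C_def]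
    have "card (L - {w}) \<noteq> 0" using L finL by (simp add: card_Diff_singleton)
    then have neX: "L - {w} \<noteq> {}" by force
    have sub: "V - (L - {w}) \<subset> V" "V - (L - {w}) \<noteq> {}" "F0 \<subseteq> F" "F0 \<subseteq> Pow (V - (L - {w}))"
      using L neX FP by (auto simp: F0_def)
    note ih = IH[OF sub]
    have cV: "card V - 1 = (card (V - (L - {w})) - 1) + (card L - 1)"
    proof -
      have "card (V - (L - {w})) = card V - card (L - {w})"
        using L finL by (intro card_Diff_subset) auto
      moreover have "card (L - {w}) = card L - 1" using L finL by (simp add: card_Diff_singleton)
      moreover have "card L \<le> card V" using L finV by (simp add: card_mono)
      ultimately show ?thesis using L(3) by simp
    qed
    have ub: "card F * (N - 1) \<le> (card V - 1) * C"
      using add_le_mono[OF conjunct1[OF ih] sm(1)] unfolding cF cV add_mult_distrib .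
    moreover have "clique_tree N C V F" if eq: "card F * (N - 1) = (card V - 1) * C"
    proof -
      have "card F0 * (N - 1) + card F1 * (N - 1) = (card (V - (L - {w})) - 1) * C + (card L - 1) * C"
        using eq unfolding cF cV by (simp add: add_mult_distrib)
      then have e0: "card F0 * (N - 1) = (card (V - (L - {w})) - 1) * C"
        and e1: "card F1 * (N - 1) = (card L - 1) * C"
        using ih sm(1) by linarith+
      have ct: "clique_tree N C (V - (L - {w})) F0" using ih e0 by blast
      have m: "card L = N" "b = N choose 2" using sm(2)[OF e1] by auto
      have "{p \<in> [L]\<^bsup>2\<^esup>. \<exists>e\<in>F1. p \<subseteq> e} = [L]\<^bsup>2\<^esup>"
        by (rule card_subset_eq) (use m finL in \<open>auto simp: b_def finite_imp_finite_nsets\<close>)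
      then have full: "\<exists>e\<in>F1. {y, z} \<subseteq> e" if "y \<in> L" "z \<in> L" "y \<noteq> z" for y z
        using that doubleton_in_nsets_2[of y z L] by blast
      have "card F1 = C" using e1 m L(3) by simp
      then have "clique_tree N C ((V - (L - {w})) \<union> L) (F0 \<union> F1)"
        using ct finL m(1) L F1P full by (intro clique_tree.glue[where x = w]) auto
      moreover have "(V - (L - {w})) \<union> L = V" using L by auto
      ultimately show ?thesis using FU by simp
    qed
    ultimately show ?thesis by blast
  qed
  then show ?case unfolding N_def[symmetric] C_def[symmetric] Nk(1) .
qed

section \<open>From hyperedges to representing pairs\<close>

text \<open>
  Hall's marriage theorem, by the argument of Halmos and Vaughan: either some proper subfamily is tight
  and can be split off, or an arbitrary first choice preserves the condition.
\<close>
lemma hall_representatives: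
  fixes N :: "'a \<Rightarrow> 'b set"
  assumes "finite A" "\<And>a. a \<in> A \<Longrightarrow> finite (N a)"
    and "\<And>S. S \<subseteq> A \<Longrightarrow> card S \<le> card (\<Union>(N ` S))"
  shows "\<exists>f. inj_on f A \<and> (\<forall>a\<in>A. f a \<in> N a)"
  using assms
proof (induction "card A" arbitrary: A N rule: less_induct)
  case less
  note fin = less.prems(1) and finN = less.prems(2) and hall = less.prems(3)
  show ?case
  proof (cases "A = {}")
    case True
    then show ?thesis by simp
  next
    case ne: False
    show ?thesis
    proof (cases "\<exists>S. S \<noteq> {} \<and> S \<subset> A \<and> card S = card (\<Union>(N ` S))")
      case True
      then obtain S where S: "S \<noteq> {}" "S \<subset> A" "card S = card (\<Union>(N ` S))" by blast
      define U where "U = \<Union>(N ` S)"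
      have finS: "finite S" and finU: "finite U"
        using S fin finN finite_subset unfolding U_def by (blast, blast)
      have "card S < card A" by (rule psubset_card_mono[OF fin S(2)])
      from less.hyps[OF this finS] obtain f0 where f0: "inj_on f0 S" "\<And>a. a \<in> S \<Longrightarrow> f0 a \<in> N a"
        using finN hall S by (metis psubsetE subsetD subset_trans)
      have "card (A - S) < card A" using S fin by (intro psubset_card_mono) auto
      moreover have "card T \<le> card (\<Union>((\<lambda>x. N x - U) ` T))" if T: "T \<subseteq> A - S" for T
      proof -
        have finT: "finite T" using T fin finite_subset by blast
        have "card T + card S = card (T \<union> S)"
          using T finT finS by (subst card_Un_disjoint) auto
        also have "\<dots> \<le> card (\<Union>(N ` (T \<union> S)))" using hall T S by blast
        also have "\<Union>(N ` (T \<union> S)) = \<Union>((\<lambda>x. N x - U) ` T) \<union> U" by (auto simp: U_def)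
        also have "card \<dots> = card (\<Union>((\<lambda>x. N x - U) ` T)) + card U"
          using T finT finU finN by (intro card_Un_disjoint) auto
        finally show ?thesis using S(3) by (simp add: U_def)
      qed
      ultimately obtain f1 where f1: "inj_on f1 (A - S)" "\<And>a. a \<in> A - S \<Longrightarrow> f1 a \<in> N a - U"
        using less.hyps[of "A - S" "\<lambda>x. N x - U"] fin finN by (metis Diff_iff finite_Diff)
      define f where "f a = (if a \<in> S then f0 a else f1 a)" for a
      have fU: "f a \<in> U" if "a \<in> S" for a using f0(2)[OF that] that by (auto simp: f_def U_def)
      have fU': "f a \<notin> U" if "a \<in> A - S" for a using f1(2)[OF that] that by (auto simp: f_def)
      have "inj_on f A"
      proof (rule inj_onI)
        fix a b assume ab: "a \<in> A" "b \<in> A" "f a = f b"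
        have "a \<in> S \<longleftrightarrow> b \<in> S" using fU fU' ab by (metis DiffI)
        then show "a = b" using ab f0(1) f1(1) by (auto simp: f_def inj_on_def split: if_splits)
      qed
      moreover have "\<forall>a\<in>A. f a \<in> N a" using f0(2) f1(2) by (auto simp: f_def)
      ultimately show ?thesis by blast
    next
      case False
      obtain a where a: "a \<in> A" using ne by blast
      have "card {a} \<le> card (N a)" using hall[of "{a}"] a by simp
      then obtain b where b: "b \<in> N a" by fastforce
      have "card (A - {a}) < card A" using a fin by (intro psubset_card_mono) auto
      moreover have "card T \<le> card (\<Union>((\<lambda>x. N x - {b}) ` T))" if T: "T \<subseteq> A - {a}" for T
      proof (cases "T = {}")
        case ne: False
        have "T \<subset> A" using T a by blast
        then have "card T < card (\<Union>(N ` T))"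
          using False ne hall[of T] by (metis le_neq_implies_less psubset_imp_subset)
        moreover have "\<Union>((\<lambda>x. N x - {b}) ` T) = \<Union>(N ` T) - {b}" by auto
        moreover have "card (\<Union>(N ` T)) - 1 \<le> card (\<Union>(N ` T) - {b})"
          by (simp add: card_Diff_singleton_if)
        ultimately show ?thesis by simp
      qed simp
      ultimately obtain f1 where f1: "inj_on f1 (A - {a})" "\<And>x. x \<in> A - {a} \<Longrightarrow> f1 x \<in> N x - {b}"
        using less.hyps[of "A - {a}" "\<lambda>x. N x - {b}"] fin finN by (metis Diff_iff finite_Diff)
      have "inj_on (f1(a := b)) A" using f1 by (auto simp: inj_on_def)
      moreover have "\<forall>x\<in>A. (f1(a := b)) x \<in> N x" using f1 b by auto
      ultimately show ?thesis by blast
    qed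
  qed
qed

text \<open>
  If \<open>A\<close> maximises the surplus of its elements over their neighbours, then enlarging \<open>A\<close> and shrinking
  \<open>A\<close> give the Hall conditions for the two sides. The strict inequality comes from taking \<open>A\<close> as
  large as possible among all maximisers; the weight \<open>\<phi>\<close> below orders sets by surplus first and by size second.
\<close>
lemma surplus_decomposition:
  fixes N :: "'a \<Rightarrow> 'b set"
  assumes fin: "finite H" and finN: "\<And>e. e \<in> H \<Longrightarrow> finite (N e)"
  obtains A where "A \<subseteq> H"
    and "\<And>S. S \<subseteq> H - A \<Longrightarrow> S \<noteq> {} \<Longrightarrow> card S < card (\<Union>(N ` S) - \<Union>(N ` A))"
    and "\<And>T. T \<subseteq> \<Union>(N ` A) \<Longrightarrow> card T \<le> card {e \<in> A. N e \<inter> T \<noteq> {}}"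
proof -
  define h where "h = int (card H)"
  define \<phi> where "\<phi> S = (int (card S) - int (card (\<Union>(N ` S)))) * (h + 1) + int (card S)" for S
  have "\<exists>A\<in>Pow H. \<forall>S\<in>Pow H. \<phi> S \<le> \<phi> A"
  proof -
    have f: "finite (\<phi> ` Pow H)" "\<phi> ` Pow H \<noteq> {}" using fin by auto
    obtain A where "A \<in> Pow H" "\<phi> A = Max (\<phi> ` Pow H)" using Max_in[OF f] by (metis imageE)
    then show ?thesis using Max_ge[OF f(1)] by (metis imageI)
  qed
  then obtain A where A: "A \<subseteq> H" and mx: "\<And>S. S \<subseteq> H \<Longrightarrow> \<phi> S \<le> \<phi> A" by blast
  have finA: "finite A" using A fin finite_subset by blast
  have finU: "finite (\<Union>(N ` S))" if "S \<subseteq> H" for S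
    using that fin finN finite_subset by blast
  show thesis
  proof (rule that[OF A])
    fix S assume S: "S \<subseteq> H - A" "S \<noteq> {}"
    have finS: "finite S" using S fin finite_subset by blast
    then have S0: "0 < card S" using S by (simp add: card_gt_0_iff)
    have "card (A \<union> S) = card A + card S" using S finS finA by (intro card_Un_disjoint) auto
    moreover have "card (\<Union>(N ` (A \<union> S))) = card (\<Union>(N ` A)) + card (\<Union>(N ` S) - \<Union>(N ` A))"
    proof -
      have "\<Union>(N ` (A \<union> S)) = \<Union>(N ` A) \<union> (\<Union>(N ` S) - \<Union>(N ` A))" by auto
      moreover have "finite (\<Union>(N ` S))" using finU[of S] S(1) by blast
      ultimately show ?thesis using card_Un_disjoint[OF finU[OF A], of "\<Union>(N ` S) - \<Union>(N ` A)"]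
        by (simp add: Diff_disjoint)
    qed
    moreover have "\<phi> (A \<union> S) \<le> \<phi> A" using mx A S by blast
    ultimately have "(int (card S) - int (card (\<Union>(N ` S) - \<Union>(N ` A)))) * (h + 1) + int (card S) \<le> 0"
      by (simp add: \<phi>_def algebra_simps)
    then have "(int (card S) - int (card (\<Union>(N ` S) - \<Union>(N ` A)))) * (h + 1) < 0" using S0 by linarith
    then show "card S < card (\<Union>(N ` S) - \<Union>(N ` A))" by (simp add: h_def mult_less_0_iff)
  next
    fix T assume T: "T \<subseteq> \<Union>(N ` A)"
    define B where "B = {e \<in> A. N e \<inter> T \<noteq> {}}"
    have B: "B \<subseteq> A" by (auto simp: B_def)
    have finT: "finite T" using T finU[OF A] finite_subset by blast
    have "card (A - B) = card A - card B" using B finA by (meson card_Diff_subset finite_subset)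
    then have c1: "int (card (A - B)) = int (card A) - int (card B)"
      using card_mono[OF finA B] by simp
    have "card (\<Union>(N ` (A - B))) \<le> card (\<Union>(N ` A) - T)"
      using finU[OF A] by (intro card_mono) (auto simp: B_def)
    also have "\<dots> = card (\<Union>(N ` A)) - card T" using T finT by (simp add: card_Diff_subset)
    finally have c2: "int (card (\<Union>(N ` (A - B)))) \<le> int (card (\<Union>(N ` A))) - int (card T)"
      using card_mono[OF finU[OF A] T] by simp
    show "card T \<le> card {e \<in> A. N e \<inter> T \<noteq> {}}"
    proof (rule ccontr)
      assume "\<not> ?thesis"
      then have lt: "int (card B) + 1 \<le> int (card T)" by (simp add: B_def)
      have "int (card A) - int (card (\<Union>(N ` A))) + 1 \<le> int (card (A - B)) - int (card (\<Union>(N ` (A - B))))"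
        using c1 c2 lt by linarith
      then have "(int (card A) - int (card (\<Union>(N ` A))) + 1) * (h + 1)
          \<le> (int (card (A - B)) - int (card (\<Union>(N ` (A - B))))) * (h + 1)"
        by (rule mult_right_mono) (simp add: h_def)
      moreover have "\<phi> (A - B) \<le> \<phi> A" using mx A by blast
      moreover have "int (card A) \<le> h" using card_mono[OF fin A] by (simp add: h_def)
      ultimately show False using c1 by (simp add: \<phi>_def algebra_simps)
    qed
  qed
qed

lemma berge_cycle_of_graph_cycle:
  assumes cyc: "graph_cycle E xs" and V: "H \<subseteq> Pow V"
    and inj: "inj_on \<rho> {{x, y} |x y. E x y}"
    and rep: "\<And>x y. E x y \<Longrightarrow> \<rho> {x, y} \<in> H \<and> {x, y} \<subseteq> \<rho> {x, y}"
  shows "berge_cycle V H (length xs) (\<lambda>i. xs ! i) (\<lambda>i. \<rho> {xs ! i, xs ! ((i + 1) mod length xs)})"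
proof -
  define l where "l = length xs"
  have l: "3 \<le> l" and dist: "distinct xs" and suc: "successively E xs" and last: "E (last xs) (hd xs)"
    using cyc by (auto simp: graph_cycle_def graph_path_def l_def)
  have E: "E (xs ! i) (xs ! ((i + 1) mod l))" if "i < l" for i
  proof (cases "Suc i < l")
    case True
    then show ?thesis using successively_nth[OF suc, of i] by (simp add: l_def)
  next
    case False
    then have "i = l - 1" using that by simp
    moreover have "xs \<noteq> []" using l by (auto simp: l_def)
    ultimately show ?thesis using last l by (simp add: last_conv_nth hd_conv_nth l_def)
  qed
  have "inj_on (\<lambda>i. {xs ! i, xs ! ((i + 1) mod l)}) {..<l}"
  proof (rule inj_onI)
    fix i j assume ij: "i \<in> {..<l}" "j \<in> {..<l}"
      and eq: "{xs ! i, xs ! ((i + 1) mod l)} = {xs ! j, xs ! ((j + 1) mod l)}"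
    have bd: "(i + 1) mod l < l" "(j + 1) mod l < l" using l by auto
    have "i = j \<or> i = (j + 1) mod l \<and> (i + 1) mod l = j"
      using eq ij bd dist unfolding doubleton_eq_iff by (auto simp: nth_eq_iff_index_eq l_def)
    moreover have "\<not> (i = (j + 1) mod l \<and> (i + 1) mod l = j)"
    proof
      assume a: "i = (j + 1) mod l \<and> (i + 1) mod l = j"
      show False
      proof (cases "j + 1 < l")
        case True
        then have "i = j + 1" using a by simp
        moreover have "\<not> i + 1 < l" using a \<open>i = j + 1\<close> by auto
        then have "i + 1 = l" using ij by simp
        then have "(i + 1) mod l = 0" by simp
        then have "j = 0" using a by (metis One_nat_def)
        ultimately show False using l \<open>i + 1 = l\<close> by linarith
      next
        case False
        then have "j + 1 = l" using ij by simp
        then show False using a l by auto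
      qed
    qed
    ultimately show "i = j" by blast
  qed
  moreover have "(\<lambda>i. {xs ! i, xs ! ((i + 1) mod l)}) ` {..<l} \<subseteq> {{x, y} |x y. E x y}"
    using E by blast
  ultimately have "inj_on (\<rho> \<circ> (\<lambda>i. {xs ! i, xs ! ((i + 1) mod l)})) {..<l}"
    using inj by (meson comp_inj_on inj_on_subset)
  then have "inj_on (\<lambda>i. \<rho> {xs ! i, xs ! ((i + 1) mod l)}) {..<l}" by (simp add: comp_def)
  moreover have "inj_on ((!) xs) {..<l}" using dist by (auto simp: inj_on_def nth_eq_iff_index_eq l_def)
  moreover have "xs ! i \<in> V" if "i < l" for i using rep[OF E[OF that]] V by blast
  ultimately show ?thesis using rep E unfolding berge_cycle_def l_def[symmetric] by blast
qed

text \<open>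
  Both representations \<open>f\<close> and \<open>g\<close> together assign different hyperedges to different edges of the shadow
  graph of \<open>f ` (H - A) \<union> A\<close>, so long cycles there would be long Berge cycles.
\<close>
lemma represented_family_bound:
  fixes V :: "'a set" and H A :: "'a set set"
  assumes r: "3 \<le> r" and k: "r + 3 \<le> k" and V: "finite V" "V \<noteq> {}"
    and H: "H \<subseteq> [V]\<^bsup>r\<^esup>" and A: "A \<subseteq> H"
    and noberge: "\<And>l v e. l \<ge> k \<Longrightarrow> \<not> berge_cycle V H l v e"
    and f: "inj_on f (H - A)" "\<And>s. s \<in> H - A \<Longrightarrow> f s \<in> [s]\<^bsup>2\<^esup> - (\<Union>e\<in>A. [e]\<^bsup>2\<^esup>)"
    and g: "inj_on g (\<Union>e\<in>A. [e]\<^bsup>2\<^esup>)" "\<And>p. p \<in> (\<Union>e\<in>A. [e]\<^bsup>2\<^esup>) \<Longrightarrow> g p \<in> A \<and> p \<subseteq> g p"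
  shows "card H * (k - 2) \<le> (card V - 1) * ((k - 1) choose r)"
    and "card H * (k - 2) = (card V - 1) * ((k - 1) choose r) \<Longrightarrow>
      clique_tree (k - 1) ((k - 1) choose r) V (f ` (H - A) \<union> A)"
proof -
  define R F where "R = f ` (H - A)" and "F = R \<union> A"
  define P where "P = (\<Union>e\<in>A. [e]\<^bsup>2\<^esup>)"
  have R2: "card p = 2 \<and> p \<notin> P \<and> p \<subseteq> V" if "p \<in> R" for p
    using that f(2) H by (force simp: R_def P_def nsets_def)
  have Ar: "card e = r \<and> e \<subseteq> V \<and> finite e" if "e \<in> A" for e
    using that A H by (auto simp: nsets_def)
  have finH: "finite H" using finite_subset[OF H] V by (simp add: finite_imp_finite_nsets)
  have "R \<inter> A = {}" using R2 Ar r by fastforce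
  then have "card F = card R + card A"
    unfolding F_def using finH A finite_subset by (intro card_Un_disjoint) (auto simp: R_def)
  moreover have "card R = card (H - A)" unfolding R_def using f(1) by (rule card_image)
  moreover have "card (H - A) + card A = card H"
    using A finH by (metis card_Diff_subset card_mono finite_subset le_add_diff_inverse2)
  ultimately have cF: "card F = card H" by simp
  have F: "F \<subseteq> [V]\<^bsup>2\<^esup> \<union> [V]\<^bsup>r\<^esup>"
    using R2 Ar V by (auto simp: F_def nsets_def intro: finite_subset)
  have anti: "\<not> p \<subseteq> e" if "p \<in> F" "e \<in> F" "card p = 2" "card e = r" for p e
  proof -
    have "p \<in> R" using that(1,3) Ar r by (force simp: F_def)
    moreover have "e \<in> A" using that(2,4) R2 r by (force simp: F_def)
    ultimately show ?thesis using R2[of p] Ar[of e] that(3) unfolding P_def nsets_def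
      by (auto intro: finite_subset)
  qed
  define \<rho> where "\<rho> p = (if p \<in> R then inv_into (H - A) f p else g p)" for p
  have rp: "(p \<in> R \<and> \<rho> p \<in> H - A \<and> f (\<rho> p) = p \<or> p \<in> P \<and> \<rho> p = g p) \<and> \<rho> p \<in> H \<and> p \<subseteq> \<rho> p"
    if p: "p = {x, y}" "shadow_adj F x y" for p x y
  proof -
    obtain e where e: "e \<in> F" "p \<subseteq> e" "card p = 2" using p by (auto simp: shadow_adj_def)
    show ?thesis
    proof (cases "p \<in> R")
      case True
      then have "\<rho> p \<in> H - A" "f (\<rho> p) = p"
        unfolding \<rho>_def R_def by (auto simp: inv_into_f_f[OF f(1)])
      moreover have "p \<subseteq> \<rho> p" using f(2)[OF calculation(1)] calculation(2) by (auto simp: nsets_def)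
      ultimately show ?thesis using True by blast
    next
      case False
      have "e \<notin> R"
      proof
        assume "e \<in> R"
        then have "card e = 2" using R2 by blast
        then have "p = e" using e by (metis card_subset_eq card.infinite zero_neq_numeral)
        then show False using \<open>e \<in> R\<close> False by simp
      qed
      then have "p \<in> P" using e p by (auto simp: F_def P_def nsets_def)
      then show ?thesis using False g(2) A by (auto simp: \<rho>_def P_def[symmetric])
    qed
  qed
  have inj: "inj_on \<rho> {{x, y} |x y. shadow_adj F x y}"
  proof (rule inj_onI)
    fix p q assume p: "p \<in> {{x, y} |x y. shadow_adj F x y}" and q: "q \<in> {{x, y} |x y. shadow_adj F x y}" and eq: "\<rho> p = \<rho> q"
    have p': "p \<in> R \<and> \<rho> p \<in> H - A \<and> f (\<rho> p) = p \<or> p \<in> P \<and> \<rho> p = g p"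
      and q': "q \<in> R \<and> \<rho> q \<in> H - A \<and> f (\<rho> q) = q \<or> q \<in> P \<and> \<rho> q = g q"
      using p q rp by blast+
    then show "p = q" using eq g unfolding P_def[symmetric] inj_on_def by (metis DiffD2)
  qed
  have HP: "H \<subseteq> Pow V" using H by (auto simp: nsets_def)
  have cyc: "length xs < k" if "graph_cycle (shadow_adj F) xs" for xs
  proof (rule ccontr)
    have "\<rho> {x, y} \<in> H \<and> {x, y} \<subseteq> \<rho> {x, y}" if "shadow_adj F x y" for x y
      using rp[OF refl that] by (rule conjunct2)
    note berge_cycle_of_graph_cycle[OF that HP inj this]
    moreover assume "\<not> length xs < k"
    ultimately show False using noberge[of "length xs"] by simp
  qed
  have "card F * (k - 2) \<le> (card V - 1) * ((k - 1) choose r) \<and>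
    (card F * (k - 2) = (card V - 1) * ((k - 1) choose r) \<longrightarrow>
      clique_tree (k - 1) ((k - 1) choose r) V F)"
    by (rule mixed_family_bound[OF r k V F]) (fact anti, fact cyc)
  then show "card H * (k - 2) \<le> (card V - 1) * ((k - 1) choose r)"
    and "card H * (k - 2) = (card V - 1) * ((k - 1) choose r) \<Longrightarrow>
      clique_tree (k - 1) ((k - 1) choose r) V (f ` (H - A) \<union> A)"
    unfolding cF by (auto simp: F_def R_def)
qed

text \<open>
  The representation \<open>f\<close> stays free in the following argument: each admissible choice of it yields a
  clique tree if equality holds, and two choices that differ in one pair contradict each other.
\<close>
theorem berge_bound:
  fixes V :: "'a set" and H :: "'a set set"
  assumes r: "3 \<le> r" and k: "r + 3 \<le> k" and V: "finite V" "V \<noteq> {}"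
    and H: "H \<subseteq> [V]\<^bsup>r\<^esup>"
    and noberge: "\<And>l v e. l \<ge> k \<Longrightarrow> \<not> berge_cycle V H l v e"
  shows "card H * (k - 2) \<le> (card V - 1) * ((k - 1) choose r)"
    and "card H * (k - 2) = (card V - 1) * ((k - 1) choose r) \<Longrightarrow>
      clique_tree (k - 1) ((k - 1) choose r) V H"
proof -
  have finH: "finite H" using finite_subset[OF H] V by (simp add: finite_imp_finite_nsets)
  have finN: "finite ([e]\<^bsup>2\<^esup>)" if "e \<in> H" for e
    using that H by (auto simp: nsets_def intro: finite_imp_finite_nsets[unfolded nsets_def])
  obtain A where A: "A \<subseteq> H"
    and S: "\<And>S. S \<subseteq> H - A \<Longrightarrow> S \<noteq> {} \<Longrightarrow> card S < card ((\<Union>e\<in>S. [e]\<^bsup>2\<^esup>) - (\<Union>e\<in>A. [e]\<^bsup>2\<^esup>))"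
    and T: "\<And>T. T \<subseteq> (\<Union>e\<in>A. [e]\<^bsup>2\<^esup>) \<Longrightarrow> card T \<le> card {e \<in> A. [e]\<^bsup>2\<^esup> \<inter> T \<noteq> {}}"
    using surplus_decomposition[of H "\<lambda>e. [e]\<^bsup>2\<^esup>"] finH finN by blast
  define P where "P = (\<Union>e\<in>A. [e]\<^bsup>2\<^esup>)"
  have finA: "finite A" using A finH finite_subset by blast
  have finP: "finite P" using finA finN A by (auto simp: P_def)
  have "\<exists>f. inj_on f (H - A) \<and> (\<forall>s\<in>H - A. f s \<in> [s]\<^bsup>2\<^esup> - P)"
  proof (rule hall_representatives)
    fix Q assume Q: "Q \<subseteq> H - A"
    have e: "(\<Union>s\<in>Q. [s]\<^bsup>2\<^esup> - P) = (\<Union>e\<in>Q. [e]\<^bsup>2\<^esup>) - (\<Union>e\<in>A. [e]\<^bsup>2\<^esup>)" by (auto simp: P_def)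
    show "card Q \<le> card (\<Union>s\<in>Q. [s]\<^bsup>2\<^esup> - P)" unfolding e
      using S[OF Q] by (cases "Q = {}") auto
  qed (use finH finN in auto)
  then obtain f where f: "inj_on f (H - A)" "\<And>s. s \<in> H - A \<Longrightarrow> f s \<in> [s]\<^bsup>2\<^esup> - P" by blast
  have "\<exists>g. inj_on g P \<and> (\<forall>p\<in>P. g p \<in> {e \<in> A. p \<in> [e]\<^bsup>2\<^esup>})"
  proof (rule hall_representatives[OF finP])
    fix Q assume Q: "Q \<subseteq> P"
    have "(\<Union>p\<in>Q. {e \<in> A. p \<in> [e]\<^bsup>2\<^esup>}) = {e \<in> A. [e]\<^bsup>2\<^esup> \<inter> Q \<noteq> {}}" by auto
    then show "card Q \<le> card (\<Union>p\<in>Q. {e \<in> A. p \<in> [e]\<^bsup>2\<^esup>})"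
      using T Q by (simp add: P_def)
  qed (use finA in auto)
  then obtain g where g: "inj_on g P" "\<And>p. p \<in> P \<Longrightarrow> g p \<in> A \<and> p \<subseteq> g p"
    by (auto simp: nsets_def)
  have rep: "card H * (k - 2) \<le> (card V - 1) * ((k - 1) choose r) \<and> 
      (card H * (k - 2) = (card V - 1) * ((k - 1) choose r) \<longrightarrow>
      clique_tree (k - 1) ((k - 1) choose r) V (f' ` (H - A) \<union> A))"
    if "inj_on f' (H - A)" "\<And>s. s \<in> H - A \<Longrightarrow> f' s \<in> [s]\<^bsup>2\<^esup> - P" for f'
    using represented_family_bound[OF r k V H A noberge that(1) that(2)[unfolded P_def] g[unfolded P_def]]
    by blast
  show "card H * (k - 2) \<le> (card V - 1) * ((k - 1) choose r)" using rep[OF f] by blast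
  assume eq: "card H * (k - 2) = (card V - 1) * ((k - 1) choose r)"
  have "H - A = {}"
  proof (rule ccontr)
    assume ne: "H - A \<noteq> {}"
    let ?R = "f ` (H - A)"
    have "card ?R = card (H - A)" using f(1) by (rule card_image)
    then have lt: "card ?R < card ((\<Union>e\<in>H - A. [e]\<^bsup>2\<^esup>) - P)" using S[OF _ ne] by (simp add: P_def)
    have "\<not> (\<Union>e\<in>H - A. [e]\<^bsup>2\<^esup>) - P \<subseteq> ?R"
      using card_mono[of ?R] finH lt by (meson finite_Diff finite_imageI not_le)
    then obtain q s where q: "s \<in> H - A" "q \<in> [s]\<^bsup>2\<^esup>" "q \<notin> P" "q \<notin> ?R" by blast
    \<comment> \<open>The pair \<open>f s\<close> loses its place to \<open>q\<close>, but its two ends keep their common neighbours.\<close>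
    define f' where "f' = f(s := q)"
    have f': "inj_on f' (H - A)" "\<And>x. x \<in> H - A \<Longrightarrow> f' x \<in> [x]\<^bsup>2\<^esup> - P"
      using f q by (auto simp: f'_def inj_on_def)
    let ?F = "?R \<union> A" and ?F' = "f' ` (H - A) \<union> A"
    have ct: "clique_tree (k - 1) ((k - 1) choose r) V ?F" using rep[OF f] eq by blast
    have ct': "clique_tree (k - 1) ((k - 1) choose r) V ?F'" using rep[OF f'] eq by blast
    have fs: "f s \<in> [s]\<^bsup>2\<^esup>" "f s \<notin> P" using f(2)[OF q(1)] by auto
    then obtain x y where xy: "f s = {x, y}" "x \<noteq> y" by (auto simp: nsets_def card_2_iff)
    have memR: "card p = 2" if "p \<in> f ` (H - A) \<union> f' ` (H - A)" for p
      using that f(2) f'(2) by (auto simp: nsets_def)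
    have two: "{a, b} = p" if "card p = 2" "{a, b} \<subseteq> p" "a \<noteq> b" for a b :: 'a and p
      using that by (intro card_subset_eq) (auto intro: card_ge_0_finite)
    have adjF: "shadow_adj (h ` (H - A) \<union> A) a b \<longleftrightarrow> a \<noteq> b \<and> ({a, b} \<in> h ` (H - A) \<or> {a, b} \<in> P)"
      if "h = f \<or> h = f'" for h a b
    proof
      assume "shadow_adj (h ` (H - A) \<union> A) a b"
      then obtain e where e: "a \<noteq> b" "e \<in> h ` (H - A) \<union> A" "{a, b} \<subseteq> e" by (auto simp: shadow_adj_def)
      then show "a \<noteq> b \<and> ({a, b} \<in> h ` (H - A) \<or> {a, b} \<in> P)"
        using that memR two[of e a b] by (auto simp: P_def nsets_def)
    qed (auto simp: shadow_adj_def P_def nsets_def)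
    have "shadow_adj ?F x y" using xy q(1) adjF[of f] by (metis imageI)
    then obtain z w where zw: "z \<noteq> w" "shadow_adj ?F x z" "shadow_adj ?F y z" "shadow_adj ?F x w" "shadow_adj ?F y w"
      using clique_tree_common_neighbours[OF ct, of x y] r k by fastforce
    have up: "shadow_adj ?F' a b" if ab: "shadow_adj ?F a b" "{a, b} \<noteq> f s" for a b
    proof -
      have "a \<noteq> b \<and> ({a, b} \<in> ?R \<or> {a, b} \<in> P)" using ab(1) adjF[of f] by simp
      moreover have "{a, b} \<in> f' ` (H - A)" if "{a, b} \<in> ?R"
        using that ab(2) by (auto simp: f'_def)
      ultimately show ?thesis using adjF[of f' a b] by blast
    qed
    have n: "z \<noteq> x" "z \<noteq> y" "w \<noteq> x" "w \<noteq> y" using zw by (auto simp: shadow_adj_def)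
    have nf: "{x, z} \<noteq> f s" "{y, z} \<noteq> f s" "{x, w} \<noteq> f s" "{y, w} \<noteq> f s"
      using n unfolding xy(1) doubleton_eq_iff by blast+
    have "shadow_adj ?F' x y"
      by (rule clique_tree_adjacent_if_common[OF ct' xy(2) zw(1) up[OF zw(2) nf(1)]
          up[OF zw(3) nf(2)] up[OF zw(4) nf(3)] up[OF zw(5) nf(4)]])
    then have "f s \<in> f' ` (H - A)" using adjF[of f'] fs xy by simp
    then obtain t where t: "t \<in> H - A" "f s = f' t" by blast
    show False
    proof (cases "t = s")
      case True
      then have "f s = q" using t by (simp add: f'_def)
      then show False using q by blast
    next
      case False
      then have "f s = f t" using t by (simp add: f'_def)
      then show False using f(1) False t q by (auto simp: inj_on_def)
    qed
  qed
  then have "H = A" using A by blast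
  then show "clique_tree (k - 1) ((k - 1) choose r) V H" using rep[OF f] eq by simp
qed

section \<open>Counting when every edge lies in a complete piece\<close>

lemma ex_edge_containing_pair:
  assumes "finite W" "2 \<le> r" "r \<le> card W" "a \<in> W" "b \<in> W" "a \<noteq> b"
  shows "\<exists>e\<in>[W]\<^bsup>r\<^esup>. {a, b} \<subseteq> e"
proof -
  have "\<exists>e. {a, b} \<subseteq> e \<and> e \<subseteq> W \<and> card e = r"
    using assms by (intro exists_subset_between) auto
  then show ?thesis using assms(1) by (auto simp: nsets_finite_iff)
qed

lemma rtrancl_of_path:
  assumes "symp E" "successively E xs" "u \<in> set xs" "v \<in> set xs"
  shows "(u, v) \<in> {(a, b). E a b}\<^sup>*"
proof -
  have hd: "(hd xs, z) \<in> {(a, b). E a b}\<^sup>*" if "z \<in> set xs" "successively E xs" for z xs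
    using that
  proof (induction xs)
    case (Cons y ys)
    show ?case
    proof (cases "z = y")
      case False
      then have "(hd ys, z) \<in> {(a, b). E a b}\<^sup>*" "E y (hd ys)"
        using Cons by (auto simp: successively_Cons)
      then show ?thesis by (auto intro: converse_rtrancl_into_rtrancl)
    qed simp
  qed simp
  have "sym {(a, b). E a b}" using assms(1) by (auto simp: sym_def symp_def)
  then have "sym ({(a, b). E a b}\<^sup>*)" by (rule sym_rtrancl)
  then show ?thesis using hd[OF assms(3,2)] hd[OF assms(4,2)] by (meson rtrancl_trans symD)
qed

lemma path_of_rtrancl:
  assumes "(a, b) \<in> {(x, y). E x y}\<^sup>*"
  shows "\<exists>xs. xs \<noteq> [] \<and> graph_path E xs \<and> hd xs = a \<and> last xs = b"
  using assms
proof (induction rule: rtrancl_induct)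
  case base
  then show ?case by (intro exI[of _ "[a]"]) (simp add: graph_path_def)
next
  case (step y z)
  then obtain xs where xs: "xs \<noteq> []" "graph_path E xs" "hd xs = a" "last xs = y" by blast
  show ?case
  proof (cases "z \<in> set xs")
    case True
    then obtain as bs where ab: "xs = as @ z # bs" by (metis split_list)
    then have "xs = (as @ [z]) @ bs" by simp
    then have "graph_path E (as @ [z])" using xs(2) graph_path_append_iff by metis
    moreover have "hd (as @ [z]) = a" using xs(3) ab by (cases as) auto
    ultimately show ?thesis by (intro exI[of _ "as @ [z]"]) simp
  next
    case False
    then have "graph_path E (xs @ [z])" using xs step(2) by (auto simp: graph_path_append_iff) (simp add: graph_path_def)
    then show ?thesis using xs by (intro exI[of _ "xs @ [z]"]) simp
  qed
qed

lemma clique_tree_connected: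
  assumes "clique_tree N c V F" "2 \<le> N" "u \<in> V" "v \<in> V"
  shows "(u, v) \<in> {(a, b). shadow_adj F a b}\<^sup>*"
proof (cases "u = v")
  case False
  obtain xs where "xs \<noteq> []" "graph_path (shadow_adj F) xs" "hd xs = u" "last xs = v"
    using clique_tree_long_path[OF assms False] by blast
  then show ?thesis using rtrancl_of_path[OF shadow_adj_symp] unfolding graph_path_def
    by (metis hd_in_set last_in_set)
qed simp

text \<open>
  Every vertex has degree at least \<open>k - 2\<close>, which is large enough for a pendant set \<open>L\<close>. A vertex of
  \<open>L\<close> other than its point of attachment lies in a complete piece inside \<open>L\<close>, and by size this piece is \<open>L\<close>.
  The hypotheses pass to what remains after removing \<open>L\<close> except for that point.
\<close>
lemma complete_pieces_count:
  fixes V :: "'a set" and H :: "'a set set"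
  assumes r: "3 \<le> r" and k: "r + 3 \<le> k"
    and "finite V" "V \<noteq> {}" "H \<subseteq> [V]\<^bsup>r\<^esup>"
    and "\<And>u v. u \<in> V \<Longrightarrow> v \<in> V \<Longrightarrow> (u, v) \<in> {(a, b). shadow_adj H a b}\<^sup>*"
    and "\<And>a b. shadow_adj H a b \<Longrightarrow> \<exists>W. a \<in> W \<and> b \<in> W \<and> finite W \<and> card W = k - 1 \<and> [W]\<^bsup>r\<^esup> \<subseteq> H"
    and "\<And>xs. graph_cycle (shadow_adj H) xs \<Longrightarrow> length xs < k"
  shows "card H * (k - 2) = (card V - 1) * ((k - 1) choose r)"
  using assms(3-)
proof (induction "card V" arbitrary: V H rule: less_induct)
  case less
  note finV = less.prems(1) and neV = less.prems(2) and H = less.prems(3)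
    and conn = less.prems(4) and piece = less.prems(5) and cyc = less.prems(6)
  have HP: "H \<subseteq> Pow V" using H by (auto simp: nsets_def)
  have finH: "finite H" using finite_subset[OF H] finV by (simp add: finite_imp_finite_nsets)
  have inV: "a \<in> V \<and> b \<in> V" if "shadow_adj H a b" for a b using that HP by (auto simp: shadow_adj_def)
  have inW: "shadow_adj H a b" if Wab: "finite W" "card W = k - 1" "[W]\<^bsup>r\<^esup> \<subseteq> H" "a \<in> W" "b \<in> W" "a \<noteq> b" for W a b
  proof -
    have "2 \<le> r" "r \<le> card W" using Wab(2) r k by simp_all
    then obtain e where "e \<in> [W]\<^bsup>r\<^esup>" "{a, b} \<subseteq> e"
      using ex_edge_containing_pair[of W r a b] Wab(1,4-6) by blast
    then show ?thesis using Wab(3,6) unfolding shadow_adj_def by blast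
  qed
  show ?case
  proof (cases "card V = 1")
    case True
    then have "[V]\<^bsup>r\<^esup> = {}" using r finV by (intro nsets_eq_empty) auto
    then show ?thesis using H True by simp
  next
    case False
    have nbr: "\<exists>b. shadow_adj H a b" if a: "a \<in> V" for a
    proof -
      have "V \<noteq> {a}" using False by auto
      then obtain v where v: "v \<in> V" "v \<noteq> a" using a by blast
      have "(a, v) \<in> {(a, b). shadow_adj H a b}\<^sup>*" using conn a v(1) by blast
      then show ?thesis using v(2) by (cases rule: converse_rtranclE) auto
    qed
    have deg: "k \<le> 2 * card {y. shadow_adj H x y}" if x: "x \<in> V" for x
    proof -
      obtain b where "shadow_adj H x b" using nbr x by blast
      then obtain W where W: "x \<in> W" "finite W" "card W = k - 1" "[W]\<^bsup>r\<^esup> \<subseteq> H" using piece by blast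
      have "card (W - {x}) \<le> card {y. shadow_adj H x y}"
        by (rule card_mono[OF finite_shadow_adj[OF finV HP]]) (use inW[OF W(2-4) W(1)] in auto)
      then show ?thesis using W r k by (simp add: card_Diff_singleton)
    qed
    have "\<exists>L w. L \<subseteq> V \<and> w \<in> L \<and> 2 \<le> card L \<and> card L < k \<and>
        (\<forall>x\<in>L - {w}. \<forall>y. shadow_adj H x y \<longrightarrow> y \<in> L)"
      by (rule exists_pendant_set[OF finV neV shadow_adj_symp shadow_adj_irreflp])
         (use deg cyc k inV in auto)
    then obtain L w where L: "L \<subseteq> V" "w \<in> L" "2 \<le> card L" "card L < k"
      and pend: "\<And>x y. x \<in> L - {w} \<Longrightarrow> shadow_adj H x y \<Longrightarrow> y \<in> L" by blast
    define X where "X = L - {w}"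
    have finL: "finite L" using L(1) finV finite_subset by blast
    have cX: "card X = card L - 1" using L finL by (simp add: X_def card_Diff_singleton)
    then have "card X \<noteq> 0" using L by simp
    then obtain x where x: "x \<in> X" by fastforce
    have WL: "W \<subseteq> L" if W: "finite W" "card W = k - 1" "[W]\<^bsup>r\<^esup> \<subseteq> H" and y: "y \<in> W" "y \<in> X" for W y
    proof
      fix z assume "z \<in> W"
      then show "z \<in> L" using inW[OF W y(1), of z] pend[of y z] y X_def by (cases "z = y") auto
    qed
    obtain b where "shadow_adj H x b" using nbr x L X_def by blast
    then obtain W where W: "x \<in> W" "finite W" "card W = k - 1" "[W]\<^bsup>r\<^esup> \<subseteq> H" using piece by blast
    have "W = L" using WL[OF W(2-4,1) x] finL L(4) W(3) by (intro card_subset_eq card_seteq) auto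
    then have Lk: "card L = k - 1" "[L]\<^bsup>r\<^esup> \<subseteq> H" using W by auto
    define H0 V0 where "H0 = {e \<in> H. e \<inter> X = {}}" and "V0 = V - X"
    have meet: "e \<subseteq> L" if e: "e \<in> H" "y \<in> e" "y \<in> X" for e y
    proof
      fix z assume "z \<in> e"
      then show "z \<in> L" using pend[of y z] e X_def by (cases "z = y") (auto simp: shadow_adj_def)
    qed
    have "e \<inter> X \<noteq> {}" if "e \<in> [L]\<^bsup>r\<^esup>" for e
    proof
      assume "e \<inter> X = {}"
      then have "e \<subseteq> {w}" using that by (auto simp: X_def nsets_def)
      then have "card e \<le> 1" using card_mono[of "{w}" e] by simp
      then show False using that r by (auto simp: nsets_def)
    qed
    then have HU: "H = H0 \<union> [L]\<^bsup>r\<^esup>" "H0 \<inter> [L]\<^bsup>r\<^esup> = {}"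
      using meet H Lk(2) by (auto simp: H0_def nsets_def)
    then have cH: "card H = card H0 + ((k - 1) choose r)"
      using finH Lk(1) by (metis card_Un_disjoint card_nsets finite_Un)
    have cV: "card V - 1 = (card V0 - 1) + (k - 2)"
    proof -
      have "card V0 = card V - card X" unfolding V0_def
        using L finL by (intro card_Diff_subset) (auto simp: X_def)
      moreover have "card L \<le> card V" using L finV by (simp add: card_mono)
      ultimately show ?thesis using cX Lk(1) k by simp
    qed
    have "card H0 * (k - 2) = (card V0 - 1) * ((k - 1) choose r)"
    proof (rule less.hyps)
      have "V0 \<subset> V" using x L by (auto simp: V0_def X_def)
      then show "card V0 < card V" "finite V0" using finV psubset_card_mono finite_subset by blast+
      show "V0 \<noteq> {}" using L by (auto simp: V0_def X_def)
      show "H0 \<subseteq> [V0]\<^bsup>r\<^esup>" using H by (auto simp: H0_def V0_def nsets_def)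
      have adj0: "shadow_adj H0 a b" if ab: "shadow_adj H a b" "a \<notin> X" "b \<notin> X" for a b
      proof -
        obtain e where e: "e \<in> H" "a \<in> e" "b \<in> e" "a \<noteq> b" using ab(1) by (auto simp: shadow_adj_def)
        have "e \<inter> X = {}"
        proof (rule ccontr)
          assume "e \<inter> X \<noteq> {}"
          then have "e \<subseteq> L" using meet e by blast
          then show False using e ab by (auto simp: X_def)
        qed
        then show ?thesis using e by (auto simp: shadow_adj_def H0_def)
      qed
      have sub: "shadow_adj H0 a b \<Longrightarrow> shadow_adj H a b" for a b by (auto simp: shadow_adj_def H0_def)
      \<comment> \<open>Collapsing \<open>X\<close> to the point of attachment turns walks of the old graph into walks of the new one.\<close>
      define \<pi> where "\<pi> a = (if a \<in> X then w else a)" for a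
      have proj: "(\<pi> a, \<pi> b) \<in> {(a, b). shadow_adj H0 a b}\<^sup>*" if "shadow_adj H a b" for a b
      proof (cases "a \<in> X \<or> b \<in> X")
        case True
        then have "a \<in> L" "b \<in> L" using pend[of a b] pend[of b a] that shadow_adj_sym[OF that]
          by (auto simp: X_def)
        then have "\<pi> a = w" "\<pi> b = w" by (auto simp: \<pi>_def X_def)
        then show ?thesis by simp
      next
        case False
        then show ?thesis using adj0[OF that] by (auto simp: \<pi>_def)
      qed
      show "(u, v) \<in> {(a, b). shadow_adj H0 a b}\<^sup>*" if uv: "u \<in> V0" "v \<in> V0" for u v
      proof -
        have "(u, v) \<in> {(a, b). shadow_adj H a b}\<^sup>*" using conn uv by (auto simp: V0_def)
        then have "(\<pi> u, \<pi> v) \<in> {(a, b). shadow_adj H0 a b}\<^sup>*"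
        proof (induction rule: rtrancl_induct)
          case (step y z)
          then show ?case using proj[of y z] by (auto intro: rtrancl_trans)
        qed simp
        then show ?thesis using uv by (simp add: \<pi>_def V0_def)
      qed
      show "\<exists>W. a \<in> W \<and> b \<in> W \<and> finite W \<and> card W = k - 1 \<and> [W]\<^bsup>r\<^esup> \<subseteq> H0" if ab: "shadow_adj H0 a b" for a b
      proof -
        obtain W where W: "a \<in> W" "b \<in> W" "finite W" "card W = k - 1" "[W]\<^bsup>r\<^esup> \<subseteq> H"
          using piece[OF sub[OF ab]] by blast
        have "a \<notin> X" "b \<notin> X" "a \<noteq> b" using ab by (auto simp: shadow_adj_def H0_def)
        then have "\<not> W \<subseteq> L" using W by (auto simp: X_def)
        then have "W \<inter> X = {}" using WL[OF W(3-5)] by blast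
        then have "[W]\<^bsup>r\<^esup> \<subseteq> H0" using W(5) by (auto simp: H0_def nsets_def)
        then show ?thesis using W by blast
      qed
      show "length xs < k" if "graph_cycle (shadow_adj H0) xs" for xs
        by (rule cyc, rule graph_cycle_mono[OF that]) (rule sub)
    qed
    then show ?thesis unfolding cH cV by (simp add: add_mult_distrib)
  qed
qed

section \<open>Blocks of the shadow graph\<close>

text \<open>
  All digraphs below, the shadow graph, its induced subgraphs and its cliques, are induced by a
  relation on a vertex set; in this form deleting a vertex just shrinks the set.
\<close>
definition adj_digraph :: "('a \<Rightarrow> 'a \<Rightarrow> bool) \<Rightarrow> 'a set \<Rightarrow> ('a, 'a \<times> 'a) pre_digraph" where
  "adj_digraph E S = \<lparr> verts = S, arcs = {(a, b). a \<in> S \<and> b \<in> S \<and> E a b}, tail = fst, head = snd \<rparr>"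

lemma adj_digraph_simps [simp]:
  "verts (adj_digraph E S) = S" "arcs (adj_digraph E S) = {(a, b). a \<in> S \<and> b \<in> S \<and> E a b}"
  "tail (adj_digraph E S) = fst" "head (adj_digraph E S) = snd"
  by (simp_all add: adj_digraph_def)

lemma wf_adj_digraph: "wf_digraph (adj_digraph E S)"
  by unfold_locales auto

lemma arcs_ends_eq_arcs:
  assumes "tail G = fst" "head G = snd" shows "arcs_ends G = arcs G"
  using assms by (simp add: arcs_ends_conv)

lemma graph_adj_digraph:
  assumes "finite S" "symp E" "irreflp E"
  shows "graph (adj_digraph E S)"
proof -
  have "finite {(a, b). a \<in> S \<and> b \<in> S \<and> E a b}"
    by (rule finite_subset[of _ "S \<times> S"]) (use assms in auto)
  moreover have "symmetric (adj_digraph E S)"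
    using assms(2) by (auto simp: symmetric_def arcs_ends_eq_arcs sym_def symp_def)
  ultimately show ?thesis
    using assms by unfold_locales (auto simp: arc_to_ends_def irreflp_def)
qed

lemma shadow2_eq_adj_digraph:
  assumes "H \<subseteq> Pow V" shows "shadow2 V H = adj_digraph (shadow_adj H) V"
  using assms by (auto simp: shadow2_def adj_digraph_def shadow_adj_def with_proj_def)

lemma connected_iff_rtrancl:
  assumes "wf_digraph G" "symmetric G"
  shows "Digraph_Component.connected G \<longleftrightarrow>
    verts G \<noteq> {} \<and> (\<forall>u\<in>verts G. \<forall>v\<in>verts G. (u, v) \<in> (arcs_ends G)\<^sup>*)"
proof -
  have "symcl (arcs_ends G) = arcs_ends G"
    using assms(2) by (auto simp: symcl_def symmetric_def sym_def)
  then have "Digraph_Component.connected G \<longleftrightarrow>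
      verts G \<noteq> {} \<and> (\<forall>u\<in>verts G. \<forall>v\<in>verts G. reachable G u v)"
    by (simp add: connected_conv reachable_def)
  also have "\<dots> \<longleftrightarrow> verts G \<noteq> {} \<and> (\<forall>u\<in>verts G. \<forall>v\<in>verts G. (u, v) \<in> (arcs_ends G)\<^sup>*)"
    using wf_digraph.reachable_conv'[OF assms(1)] by blast
  finally show ?thesis .
qed

lemma symmetric_adj_digraph: "symp E \<Longrightarrow> symmetric (adj_digraph E S)"
  by (auto simp: symmetric_def arcs_ends_eq_arcs sym_def symp_def)

lemma connected_adj_digraph_if_path:
  assumes "symp E" "ys \<noteq> []" "successively E ys" "set ys = S"
  shows "Digraph_Component.connected (adj_digraph E S)"
proof -
  let ?E = "\<lambda>a b. a \<in> S \<and> b \<in> S \<and> E a b"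
  have s: "symp ?E" using assms(1) by (auto simp: symp_def)
  have "successively ?E ys"
    by (rule successively_mono[OF assms(3)]) (use assms(4) in auto)
  then have "(u, v) \<in> {(a, b). ?E a b}\<^sup>*" if "u \<in> S" "v \<in> S" for u v
    using rtrancl_of_path[OF s] that assms(4) by blast
  then show ?thesis
    using assms(2,4) by (auto simp: connected_iff_rtrancl wf_adj_digraph symmetric_adj_digraph assms(1) arcs_ends_eq_arcs)
qed

lemma del_vert_adj_digraph:
  "pre_digraph.del_vert (adj_digraph E S) v = adj_digraph E (S - {v})"
  by (auto simp: pre_digraph.del_vert_def adj_digraph_def)

text \<open>Deleting a vertex from a cycle leaves a path, and chords do no harm to connectivity.\<close>
lemma two_connected_if_cycle:
  assumes E: "symp E" "irreflp E" and cyc: "graph_cycle E xs"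
  shows "two_connected (adj_digraph E (set xs))"
proof -
  have p: "graph_path E xs" and l: "3 \<le> length xs" and c: "E (last xs) (hd xs)"
    using cyc by (auto simp: graph_cycle_def)
  have ne: "xs \<noteq> []" using l by auto
  have suc: "successively E xs" and d: "distinct xs" using p by (auto simp: graph_path_def)
  have "Digraph_Component.connected (adj_digraph E (set xs - {v}))" if v: "v \<in> set xs" for v
  proof -
    obtain as bs where ab: "xs = as @ v # bs" using split_list[OF v] by blast
    have "E (last bs) (hd as)" if "as \<noteq> []" "bs \<noteq> []" using c ab that by simp
    moreover have "successively E as" "successively E bs"
      using suc ab by (auto simp: successively_append_iff successively_Cons)
    ultimately have "successively E (bs @ as)" unfolding successively_append_iff by blast
    moreover have "bs @ as \<noteq> []" using l ab by auto
    moreover have "set (bs @ as) = set xs - {v}" using ab d by auto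
    ultimately show ?thesis using connected_adj_digraph_if_path[OF E(1)] by blast
  qed
  moreover have "card (set xs) = length xs" using d by (rule distinct_card)
  ultimately show ?thesis
    using l connected_adj_digraph_if_path[OF E(1) ne suc refl] graph_adj_digraph[OF _ E]
    by (simp add: two_connected_def del_vert_adj_digraph)
qed

lemma two_connected_complete:
  assumes "finite W" "3 \<le> card W"
  shows "two_connected (adj_digraph (\<noteq>) W)"
proof -
  have conn: "Digraph_Component.connected (adj_digraph (\<noteq>) S)" if "S \<noteq> {}" for S :: "'a set"
    using that by (auto simp: connected_iff_rtrancl wf_adj_digraph symmetric_adj_digraph symp_def arcs_ends_eq_arcs)
  have "W - {v} \<noteq> {}" for v
  proof
    assume "W - {v} = {}"
    then have "card W \<le> card {v}" by (intro card_mono) auto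
    then show False using assms by simp
  qed
  moreover have "W \<noteq> {}" using assms by auto
  ultimately show ?thesis using assms conn graph_adj_digraph[of W "(\<noteq>)"]
    by (simp add: two_connected_def del_vert_adj_digraph symp_def irreflp_def)
qed

text \<open>By finiteness: an admissible subgraph with the most vertices and arcs around \<open>B\<close> is maximal.\<close>
lemma subgraph_extends_to_block:
  assumes "finite (verts G)" "finite (arcs G)" and sub: "subgraph B G"
    and B: "two_connected B \<or> (\<exists>x y. bridge G x y \<and> verts B = {x, y} \<and> arcs B = {(x, y), (y, x)})"
  shows "\<exists>D. block G D \<and> subgraph B D"
proof -
  define P where "P B \<longleftrightarrow> two_connected B \<or> (\<exists>x y. bridge G x y \<and> verts B = {x, y} \<and> arcs B = {(x, y), (y, x)})" for B
  define Q where "Q D \<longleftrightarrow> P D \<and> subgraph D G \<and> subgraph B D" for D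
  define m where "m D = card (verts D) + card (arcs D)" for D :: "('a, 'a \<times> 'a) pre_digraph"
  have fin: "finite (verts D) \<and> finite (arcs D)" if "subgraph D G" for D
    using that assms(1,2) unfolding subgraph_def by (meson finite_subset)
  have "Q B" using assms unfolding Q_def P_def by (auto simp: subgraph_def compatible_def)
  moreover have "\<forall>D. Q D \<longrightarrow> m D < Suc (card (verts G) + card (arcs G))"
  proof (intro allI impI)
    fix D assume "Q D"
    then have "card (verts D) \<le> card (verts G)" "card (arcs D) \<le> card (arcs G)"
      using assms(1,2) by (auto simp: Q_def subgraph_def intro: card_mono)
    then show "m D < Suc (card (verts G) + card (arcs G))" by (simp add: m_def)
  qed
  ultimately obtain D where D: "Q D" "\<And>D'. Q D' \<Longrightarrow> m D' \<le> m D"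
    using ex_has_greatest_nat[of Q B m] by blast
  have "\<not> (subgraph D' G \<and> P D')" if D': "D' \<noteq> D" "subgraph D D'" for D'
  proof
    assume a: "subgraph D' G \<and> P D'"
    have "Q D'" using a D'(2) D(1) by (auto simp: Q_def subgraph_def compatible_def)
    then have le: "m D' \<le> m D" by (rule D(2))
    have s: "verts D \<subseteq> verts D'" "arcs D \<subseteq> arcs D'" "tail D = tail D'" "head D = head D'"
      using D'(2) by (auto simp: subgraph_def compatible_def)
    have f: "finite (verts D')" "finite (arcs D')" using fin a by blast+
    have "card (verts D) \<le> card (verts D')" "card (arcs D) \<le> card (arcs D')"
      using s f by (auto intro: card_mono)
    then have "card (verts D) = card (verts D')" "card (arcs D) = card (arcs D')"
      using le by (auto simp: m_def)
    then have "verts D = verts D'" "arcs D = arcs D'"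
      using card_subset_eq[OF f(1) s(1)] card_subset_eq[OF f(2) s(2)] by blast+
    then show False using s D'(1) by (simp add: pre_digraph.equality)
  qed
  then have "block G D"
    using D(1) unfolding block_def pre_digraph.max_subgraph_def Q_def P_def[symmetric] by blast
  then show ?thesis using D(1) by (auto simp: Q_def)
qed

text \<open>
  A 2-connected graph cannot spread over both sides of a gluing vertex, because deleting that vertex
  would disconnect it.
\<close>
lemma piece_within_clique:
  assumes "clique_tree N c V F" and B: "tail B = fst" "head B = snd" "wf_digraph B"
    and "two_connected B \<or> (\<exists>x y. x \<noteq> y \<and> verts B = {x, y} \<and> arcs B = {(x, y), (y, x)})"
    and "verts B \<subseteq> V" "\<And>a b. (a, b) \<in> arcs B \<Longrightarrow> shadow_adj F a b"
  shows "\<exists>W K. finite W \<and> card W = N \<and> W \<subseteq> V \<and> verts B \<subseteq> W \<and> K \<subseteq> F \<and> K \<subseteq> Pow W \<and> card K = c"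
  using assms(1,5-)
proof (induction rule: clique_tree.induct)
  case (single v)
  from single(1) show ?case
  proof
    assume "two_connected B"
    then have "3 \<le> card (verts B)" by (simp add: two_connected_def)
    then show ?thesis using card_mono[OF _ single(2)] by simp
  next
    assume "\<exists>x y. x \<noteq> y \<and> verts B = {x, y} \<and> arcs B = {(x, y), (y, x)}"
    then show ?thesis using single(2) by auto
  qed
next
  case (glue V F W x K)
  have adj: "shadow_adj (F \<union> K) a b \<longleftrightarrow> shadow_adj F a b \<or> a \<noteq> b \<and> a \<in> W \<and> b \<in> W" for a b
    by (rule shadow_adj_glue[OF glue.hyps(5)]) (rule glue.hyps(6))
  have FP: "F \<subseteq> Pow V" using glue.hyps(1) by (rule clique_tree_subset)
  have VF: "a \<in> V \<and> b \<in> V" if "shadow_adj F a b" for a b using that FP by (auto simp: shadow_adj_def)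
  have VW: "a = x" if "a \<in> V" "a \<in> W" for a using that glue.hyps(4) by blast
  consider (W) "verts B \<subseteq> W" | (V) "verts B \<subseteq> V"
    | (both) p q where "p \<in> verts B" "p \<in> V - W" "q \<in> verts B" "q \<in> W - V"
    using glue.prems(2) by blast
  then show ?case
  proof cases
    case W
    then show ?thesis using glue.hyps by (intro exI[of _ W] exI[of _ K]) auto
  next
    case V
    have "shadow_adj F a b" if ab: "(a, b) \<in> arcs B" for a b
    proof -
      have "a \<in> V" "b \<in> V" using wf_digraph.wellformed[OF B(3) ab] B V by auto
      then show ?thesis using glue.prems(3)[OF ab, unfolded adj] VW[of a] VW[of b] by auto
    qed
    then obtain W' K' where "finite W'" "card W' = N" "W' \<subseteq> V" "verts B \<subseteq> W'" "K' \<subseteq> F" "K' \<subseteq> Pow W'" "card K' = c"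
      using glue.IH[OF glue.prems(1) V] by blast
    then show ?thesis by (intro exI[of _ W'] exI[of _ K']) auto
  next
    case both
    from glue.prems(1) have False
    proof
      assume "\<exists>x y. x \<noteq> y \<and> verts B = {x, y} \<and> arcs B = {(x, y), (y, x)}"
      then have "(p, q) \<in> arcs B" using both by auto
      then show False using glue.prems(3)[of p q, unfolded adj] both VF[of p q] by auto
    next
      assume two: "two_connected B"
      then interpret B: graph B by (simp add: two_connected_def)
      define B' where "B' = pre_digraph.del_vert B x"
      have B': "verts B' = verts B - {x}" "arcs B' = {(a, b). (a, b) \<in> arcs B \<and> a \<noteq> x \<and> b \<noteq> x}"
          "tail B' = fst" "head B' = snd"
        using B by (auto simp: B'_def pre_digraph.del_vert_def)
      have wf': "wf_digraph B'" unfolding B'_def by (rule B.wf_digraph_del_vert)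
      have symB: "(b, a) \<in> arcs B" if "(a, b) \<in> arcs B" for a b
        using B.sym_arcs that B by (auto simp: symmetric_def arcs_ends_eq_arcs sym_def)
      then have sym': "symmetric B'" using B' by (auto simp: symmetric_def arcs_ends_eq_arcs sym_def)
      have "Digraph_Component.connected B'"
      proof (cases "x \<in> verts B")
        case True
        then show ?thesis using two by (simp add: two_connected_def B'_def)
      next
        \<comment> \<open>2-connectivity only speaks of deleting vertices that are present.\<close>
        case False
        then have "arcs B' = arcs B" using B'(2) B.wellformed B by fastforce
        then have "B' = B" using B' B False by (intro pre_digraph.equality) auto
        then show ?thesis using two by (simp add: two_connected_def)
      qed
      moreover have "p \<in> verts B'" "q \<in> verts B'" using both B' glue.hyps(4) by auto
      ultimately have "(p, q) \<in> (arcs_ends B')\<^sup>*"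
        using connected_iff_rtrancl[OF wf' sym'] by blast
      then have "q \<in> V"
      proof (induction rule: rtrancl_induct)
        case base
        then show ?case using both by simp
      next
        case (step y z)
        then have "(y, z) \<in> arcs B" "y \<noteq> x" using B' by (auto simp: arcs_ends_eq_arcs)
        then show ?case using glue.prems(3)[of y z, unfolded adj] step.IH VF[of y z] VW[of y] by auto
      qed
      then show False using both by simp
    qed
    then show ?thesis ..
  qed
qed

section \<open>The extremal hypergraphs\<close>

text \<open>
  The clique that contains a block is itself 2-connected, so the block is the whole clique. A clique tree
  formed by \<open>r\<close>-sets only must carry all \<open>r\<close>-sets on each clique, by their number.
\<close>
lemma clique_tree_blocks_complete:
  fixes V :: "'a set" and H :: "'a set set"
  assumes r: "2 \<le> r" "r \<le> N" "3 \<le> N" and H: "H \<subseteq> [V]\<^bsup>r\<^esup>"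
    and ct: "clique_tree N (N choose r) V H" and D: "block (shadow2 V H) D"
  shows "complete_digraph N D \<and> complete_hypergraph N r (verts D) (edges_within H (verts D))"
proof -
  have HP: "H \<subseteq> Pow V" using H by (auto simp: nsets_def)
  define G where "G = adj_digraph (shadow_adj H) V"
  have G: "shadow2 V H = G" unfolding G_def by (rule shadow2_eq_adj_digraph[OF HP])
  define P where "P = (\<lambda>B. two_connected B \<or>
      (\<exists>x y. bridge G x y \<and> verts B = {x, y} \<and> arcs B = {(x, y), (y, x)}))"
  have subD: "subgraph D G" and PD: "P D"
    and maxD: "\<And>D'. D' \<noteq> D \<Longrightarrow> subgraph D D' \<Longrightarrow> \<not> (subgraph D' G \<and> P D')"
    using D unfolding G block_def pre_digraph.max_subgraph_def P_def by blast+
  have Dth: "tail D = fst" "head D = snd" "wf_digraph D" "verts D \<subseteq> V"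
    and Darc: "\<And>a b. (a, b) \<in> arcs D \<Longrightarrow> shadow_adj H a b"
    using subD by (auto simp: subgraph_def compatible_def G_def)
  have PD': "two_connected D \<or> (\<exists>x y. x \<noteq> y \<and> verts D = {x, y} \<and> arcs D = {(x, y), (y, x)})"
    using PD unfolding P_def bridge_def by (auto simp: G_def shadow_adj_def)
  obtain W K where W: "finite W" "card W = N" "W \<subseteq> V" "verts D \<subseteq> W"
    and K: "K \<subseteq> H" "K \<subseteq> Pow W" "card K = N choose r"
    using piece_within_clique[OF ct Dth(1-3) PD' Dth(4) Darc] by blast
  have "K \<subseteq> [W]\<^bsup>r\<^esup>" using K(1,2) H by (auto simp: nsets_def)
  then have "K = [W]\<^bsup>r\<^esup>" using W K(3) by (intro card_subset_eq) (auto simp: finite_imp_finite_nsets)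
  then have WH: "[W]\<^bsup>r\<^esup> \<subseteq> H" using K(1) by simp
  let ?C = "adj_digraph (\<noteq>) W"
  have "subgraph D ?C"
    using Dth W(4) Darc wf_digraph.wellformed[OF Dth(3)]
    by (fastforce simp: subgraph_def compatible_def wf_adj_digraph shadow_adj_def)
  moreover have "subgraph ?C G"
  proof -
    have "shadow_adj H a b" if ab: "a \<in> W" "b \<in> W" "a \<noteq> b" for a b
      using ex_edge_containing_pair[OF W(1) r(1) _ ab] r(2) W(2) WH ab(3) unfolding shadow_adj_def by blast
    then show ?thesis using W(3) by (auto simp: subgraph_def compatible_def G_def wf_adj_digraph)
  qed
  moreover have "P ?C" unfolding P_def using two_connected_complete[OF W(1)] W(2) r(3) by blast
  ultimately have DC: "D = ?C" using maxD by metis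
  have "complete_digraph N D" unfolding DC complete_digraph_def
    using graph_adj_digraph[OF W(1), of "(\<noteq>)"] W(2)
    by (auto simp: arcs_ends_eq_arcs symp_def irreflp_def)
  moreover have "edges_within H W = [W]\<^bsup>r\<^esup>"
    using WH H W(1) by (auto simp: edges_within_def nsets_finite_iff) (auto simp: nsets_def)
  ultimately show ?thesis using W DC by (simp add: complete_hypergraph_def)
qed

text \<open>
  Every cycle of the shadow graph extends to a block. This bounds the cycle length by \<open>k - 1\<close>, and it puts
  every edge into a complete piece: an edge is a bridge, or else it lies on a cycle.
\<close>
lemma complete_blocks_count:
  fixes V :: "'a set" and H :: "'a set set"
  assumes r: "3 \<le> r" and k: "r + 3 \<le> k" and V: "finite V" "V \<noteq> {}" and H: "H \<subseteq> [V]\<^bsup>r\<^esup>"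
    and conn: "Digraph_Component.connected (shadow2 V H)"
    and blocks: "\<And>D. block (shadow2 V H) D \<Longrightarrow>
      complete_hypergraph (k - 1) r (verts D) (edges_within H (verts D))"
  shows "card H * (k - 2) = (card V - 1) * ((k - 1) choose r)"
proof -
  have HP: "H \<subseteq> Pow V" using H by (auto simp: nsets_def)
  define G where "G = adj_digraph (shadow_adj H) V"
  have G: "shadow2 V H = G" unfolding G_def by (rule shadow2_eq_adj_digraph[OF HP])
  have inV: "a \<in> V \<and> b \<in> V" if "shadow_adj H a b" for a b using that HP by (auto simp: shadow_adj_def)
  have fG: "finite (verts G)" "finite (arcs G)"
  proof -
    show "finite (verts G)" using V by (simp add: G_def)
    show "finite (arcs G)" by (rule finite_subset[of _ "V \<times> V"]) (use V in \<open>auto simp: G_def\<close>)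
  qed
  have blk: "\<exists>W. verts B \<subseteq> W \<and> finite W \<and> card W = k - 1 \<and> [W]\<^bsup>r\<^esup> \<subseteq> H"
    if B: "subgraph B G" "two_connected B \<or> (\<exists>x y. bridge G x y \<and> verts B = {x, y} \<and> arcs B = {(x, y), (y, x)})"
    for B
  proof -
    obtain D where D: "block G D" "subgraph B D" using subgraph_extends_to_block[OF fG B] by blast
    have "complete_hypergraph (k - 1) r (verts D) (edges_within H (verts D))"
      using blocks D(1) by (simp add: G)
    then show ?thesis using D(2)
      by (intro exI[of _ "verts D"]) (auto simp: complete_hypergraph_def edges_within_def subgraph_def)
  qed
  have cyc_piece: "\<exists>W. set xs \<subseteq> W \<and> finite W \<and> card W = k - 1 \<and> [W]\<^bsup>r\<^esup> \<subseteq> H" if xs: "graph_cycle (shadow_adj H) xs" for xs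
  proof -
    have suc: "successively (shadow_adj H) xs" and c: "shadow_adj H (last xs) (hd xs)"
      using xs by (auto simp: graph_cycle_def graph_path_def)
    have "set xs \<subseteq> V"
    proof
      fix z assume "z \<in> set xs"
      then have "(z, hd xs) \<in> {(a, b). shadow_adj H a b}\<^sup>*"
        using rtrancl_of_path[OF shadow_adj_symp suc] by (metis hd_in_set list.set_cases list.discI)
      then show "z \<in> V" using inV[OF c] inV by (cases rule: converse_rtranclE) auto
    qed
    then have "subgraph (adj_digraph (shadow_adj H) (set xs)) G"
      by (auto simp: subgraph_def compatible_def wf_adj_digraph G_def)
    from blk[OF this disjI1[OF two_connected_if_cycle[OF shadow_adj_symp shadow_adj_irreflp xs]]]
    show ?thesis by simp
  qed
  show ?thesis
  proof (rule complete_pieces_count[OF r k V H])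
    show "(u, v) \<in> {(a, b). shadow_adj H a b}\<^sup>*" if "u \<in> V" "v \<in> V" for u v
    proof -
      have "(u, v) \<in> (arcs_ends G)\<^sup>*"
        using conn that
        unfolding G G_def connected_iff_rtrancl[OF wf_adj_digraph symmetric_adj_digraph[OF shadow_adj_symp]]
        by simp
      moreover have "arcs_ends G = {(a, b). shadow_adj H a b}"
        using inV by (auto simp: G_def arcs_ends_eq_arcs)
      ultimately show ?thesis by simp
    qed
  next
    fix a b assume ab: "shadow_adj H a b"
    show "\<exists>W. a \<in> W \<and> b \<in> W \<and> finite W \<and> card W = k - 1 \<and> [W]\<^bsup>r\<^esup> \<subseteq> H"
    proof (cases "bridge G a b")
      case True
      let ?B = "\<lparr> verts = {a, b}, arcs = {(a, b), (b, a)}, tail = fst, head = snd \<rparr>"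
      have "subgraph ?B G"
        using ab inV[OF ab] shadow_adj_sym[OF ab]
        by (auto simp: subgraph_def compatible_def wf_adj_digraph G_def wf_digraph_def)
      then show ?thesis using blk[of ?B] True by auto
    next
      case False
      define R where "R x y \<longleftrightarrow> shadow_adj H x y \<and> {x, y} \<noteq> {a, b}" for x y
      let ?G' = "pre_digraph.del_arc (pre_digraph.del_arc G (a, b)) (b, a)"
      have "reachable ?G' a b" using False ab inV[OF ab] by (simp add: bridge_def G_def)
      then have "(a, b) \<in> (arcs_ends ?G')\<^sup>*" by (rule reachable_rtranclI)
      moreover have "arcs_ends ?G' \<subseteq> {(x, y). R x y}"
      proof
        fix p assume "p \<in> arcs_ends ?G'"
        then obtain x y where p: "p = (x, y)" "shadow_adj H x y" "(x, y) \<noteq> (a, b)" "(x, y) \<noteq> (b, a)"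
          by (cases p) (simp add: arcs_ends_conv pre_digraph.del_arc_def G_def)
        then show "p \<in> {(x, y). R x y}" by (simp add: R_def doubleton_eq_iff)
      qed
      ultimately have "(a, b) \<in> {(x, y). R x y}\<^sup>*" using rtrancl_mono by blast
      from path_of_rtrancl[OF this]
      obtain xs where xs: "xs \<noteq> []" "graph_path R xs" "hd xs = a" "last xs = b" by blast
      have "3 \<le> length xs"
      proof (rule ccontr)
        assume "\<not> 3 \<le> length xs"
        moreover have "length xs \<noteq> 0" using xs(1) by simp
        ultimately have "length xs = 1 \<or> length xs = 2" by linarith
        then have "xs = [a] \<or> xs = [a, b]"
          using xs(3,4) by (auto simp: length_Suc_conv numeral_2_eq_2)
        moreover have "a \<noteq> b" using ab by (simp add: shadow_adj_def)
        ultimately have "xs = [a, b]" using xs(4) by auto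
        with xs(2) have "R a b" by (simp add: graph_path_def)
        then show False by (simp add: R_def)
      qed
      moreover have "graph_path (shadow_adj H) xs" using xs(2) by (rule graph_path_mono) (simp add: R_def)
      ultimately have "graph_cycle (shadow_adj H) xs" using xs ab shadow_adj_sym[OF ab] by (simp add: graph_cycle_def)
      then show ?thesis using cyc_piece xs by (metis hd_in_set last_in_set subsetD)
    qed
  next
    fix xs assume xs: "graph_cycle (shadow_adj H) xs"
    then obtain W where W: "set xs \<subseteq> W" "finite W" "card W = k - 1" using cyc_piece by blast
    have "length xs = card (set xs)" using xs by (simp add: graph_cycle_def graph_path_def distinct_card)
    also have "\<dots> \<le> k - 1" using card_mono[OF W(2,1)] W(3) by simp
    finally show "length xs < k" using k by simp
  qed
qed

theorem theorem3p1:
  fixes V :: "'a set" and H :: "'a set set" and n r k :: nat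
  assumes "r \<ge> 3" and "k \<ge> r + 3"
    and "uniform_hypergraph r V H" and "card V = n" and "n \<ge> 1"
    and "\<And>l v e. l \<ge> k \<Longrightarrow> \<not> berge_cycle V H l v e"
  shows "real (card H) \<le> (real n - 1) / (real k - 2) * real ((k - 1) choose r) \<and>
    (real (card H) = (real n - 1) / (real k - 2) * real ((k - 1) choose r) \<longleftrightarrow>
      Digraph_Component.connected (shadow2 V H) \<and>
      (\<forall>D. block (shadow2 V H) D \<longrightarrow>
         complete_digraph (k - 1) D \<and>
         complete_hypergraph (k - 1) r (verts D) (edges_within H (verts D))))"
proof -
  let ?C = "(k - 1) choose r"
  have V: "finite V" "V \<noteq> {}" and H: "H \<subseteq> [V]\<^bsup>r\<^esup>"
    using assms(3-5) by (auto simp: uniform_hypergraph_def)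
  have HP: "H \<subseteq> Pow V" using H by (auto simp: nsets_def)
  have kp: "0 < real k - 2" using assms(1,2) by simp
  have rk: "real (k - 2) = real k - 2" and rn: "real (n - 1) = real n - 1"
    using assms(1,2,5) by (simp_all add: of_nat_diff)
  have le_iff: "real (card H) \<le> (real n - 1) / (real k - 2) * real ?C \<longleftrightarrow> card H * (k - 2) \<le> (n - 1) * ?C"
  proof -
    have "real (card H) \<le> (real n - 1) / (real k - 2) * real ?C \<longleftrightarrow>
        real (card H) * (real k - 2) \<le> (real n - 1) * real ?C"
      using kp by (simp add: pos_le_divide_eq)
    also have "\<dots> \<longleftrightarrow> real (card H * (k - 2)) \<le> real ((n - 1) * ?C)"
      by (simp only: of_nat_mult rk rn)
    finally show ?thesis by (simp only: of_nat_le_iff)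
  qed
  have eq_iff: "real (card H) = (real n - 1) / (real k - 2) * real ?C \<longleftrightarrow> card H * (k - 2) = (n - 1) * ?C"
  proof -
    have "real (card H) = (real n - 1) / (real k - 2) * real ?C \<longleftrightarrow>
        real (card H) * (real k - 2) = (real n - 1) * real ?C"
      using kp by (simp add: eq_divide_eq)
    also have "\<dots> \<longleftrightarrow> real (card H * (k - 2)) = real ((n - 1) * ?C)"
      by (simp only: of_nat_mult rk rn)
    finally show ?thesis by (simp only: of_nat_eq_iff)
  qed
  note bound = berge_bound[OF assms(1,2) V H assms(6), unfolded assms(4)]
  have "Digraph_Component.connected (shadow2 V H) \<and>
      (\<forall>D. block (shadow2 V H) D \<longrightarrow>
         complete_digraph (k - 1) D \<and>
         complete_hypergraph (k - 1) r (verts D) (edges_within H (verts D)))"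
    if "card H * (k - 2) = (n - 1) * ?C"
  proof (intro conjI allI impI)
    have ct: "clique_tree (k - 1) ?C V H" using bound(2) that by blast
    have s: "arcs_ends (adj_digraph (shadow_adj H) V) = {(a, b). shadow_adj H a b}"
      using HP by (auto simp: arcs_ends_eq_arcs shadow_adj_def)
    show "Digraph_Component.connected (shadow2 V H)"
      unfolding shadow2_eq_adj_digraph[OF HP]
        connected_iff_rtrancl[OF wf_adj_digraph symmetric_adj_digraph[OF shadow_adj_symp]] s
      using V(2) clique_tree_connected[OF ct] assms(1,2) by simp
    fix D assume "block (shadow2 V H) D"
    then show "complete_digraph (k - 1) D"
      and "complete_hypergraph (k - 1) r (verts D) (edges_within H (verts D))"
      using clique_tree_blocks_complete[OF _ _ _ H ct, of D] assms(1,2) by auto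
  qed
  moreover have "card H * (k - 2) = (n - 1) * ?C"
    if "Digraph_Component.connected (shadow2 V H)"
      and "\<forall>D. block (shadow2 V H) D \<longrightarrow>
         complete_digraph (k - 1) D \<and>
         complete_hypergraph (k - 1) r (verts D) (edges_within H (verts D))"
    using complete_blocks_count[OF assms(1,2) V H that(1)] that(2) assms(4) by blast
  ultimately show ?thesis unfolding le_iff eq_iff using bound(1) by blast
qed

end
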